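(* Let $k$ be an integer and let $G$ be a connected bipartite graph with bipartition classes $A$ and $B$, where $|A|=a$, $|B|=b$ and $b \ge a \ge k/2 \ge 4$. Suppose $G$ contains no path on $k$ vertices as a subgraph. Write $t = \lfloor (k-3)/2 \rfloor$. Then \[ |E(G)| \le t\, b + (a - t). \] Moreover, equality holds exactly in the following cases. If $k$ is odd, equality holds if and only if $G$ is isomorphic to the graph $B_1(a,b,k)$ obtained from the complete bipartite graph $K_{t,\,b}$ (with parts of sizes $t$ and $b$, the latter being the class $B$) by adding $a-t$ new pairwise non-adjacent vertices, each adjacent to the same single vertex of the part of size $b$. If $k$ is even, equality holds if and only if $G$ belongs to the family $\mathcal{B}_1(a,b,k)$ of graphs obtained from $K_{t,\,b}$ (with parts of sizes $t$ and $b$, the latter being the class $B$) by adding $a-t$ new pairwise non-adjacent vertices, each adjacent to exactly one (arbitrary, not necessarily the same) vertex of the part of size $b$.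
   Context: All graphs are finite, simple and undirected. $P_k$ denotes the path on $k$ vertices; $G$ being $P_k$-free means $G$ has no subgraph isomorphic to $P_k$. *)

theory Defs
  imports Complex_Main
begin

record 'a ugraph =
  verts :: "'a set"
  edges :: "'a set set"

definition simple_graph :: "'a ugraph \<Rightarrow> bool" where
  "simple_graph G \<longleftrightarrow>
     finite (verts G) \<and> (\<forall>e\<in>edges G. e \<subseteq> verts G \<and> card e = 2)"

definition subgraph :: "'a ugraph \<Rightarrow> 'a ugraph \<Rightarrow> bool" where
  "subgraph H G \<longleftrightarrow> simple_graph H \<and> verts H \<subseteq> verts G \<and> edges H \<subseteq> edges G"

definition graph_iso :: "'a ugraph \<Rightarrow> 'b ugraph \<Rightarrow> bool" (infix "\<simeq>\<^sub>g" 50) where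
  "G \<simeq>\<^sub>g H \<longleftrightarrow>
     (\<exists>f. bij_betw f (verts G) (verts H) \<and>
          (\<forall>u\<in>verts G. \<forall>v\<in>verts G. {u, v} \<in> edges G \<longleftrightarrow> {f u, f v} \<in> edges H))"

definition connected_graph :: "'a ugraph \<Rightarrow> bool" where
  "connected_graph G \<longleftrightarrow>
     verts G \<noteq> {} \<and>
     (\<forall>u\<in>verts G. \<forall>v\<in>verts G. (\<lambda>x y. {x, y} \<in> edges G)\<^sup>*\<^sup>* u v)"

definition bipartition :: "'a ugraph \<Rightarrow> 'a set \<Rightarrow> 'a set \<Rightarrow> bool" where
  "bipartition G A B \<longleftrightarrow>
     A \<union> B = verts G \<and> A \<inter> B = {} \<and> (\<forall>e\<in>edges G. \<exists>x\<in>A. \<exists>y\<in>B. e = {x, y})"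

definition path_graph :: "nat \<Rightarrow> nat ugraph" where
  "path_graph k = \<lparr>verts = {..<k}, edges = {{i, Suc i} | i. Suc i < k}\<rparr>"

definition path_free :: "nat \<Rightarrow> 'a ugraph \<Rightarrow> bool" where
  "path_free k G \<longleftrightarrow> \<not> (\<exists>H. subgraph H G \<and> H \<simeq>\<^sub>g path_graph k)"

definition complete_bipartite :: "nat \<Rightarrow> nat \<Rightarrow> (nat + nat) ugraph" where
  "complete_bipartite m n =
     \<lparr>verts = Inl ` {..<m} \<union> Inr ` {..<n},
      edges = {{Inl i, Inr j} | i j. i < m \<and> j < n}\<rparr>"

definition t_par :: "nat \<Rightarrow> nat" where
  "t_par k = nat \<lfloor>(real k - 3) / 2\<rfloor>"

text \<open>
  The new vertices are \<open>Inl i\<close> for \<open>t \<le> i < a\<close>, and \<open>f i\<close> is the index of the unique neighbour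
  of \<open>Inl i\<close> in the part of size \<open>b\<close>. Thus the vertices \<open>Inl i\<close> and \<open>Inr j\<close> form the classes
  of sizes \<open>a\<close> and \<open>b\<close>, respectively.
\<close>

definition pendant_extension :: "nat \<Rightarrow> nat \<Rightarrow> nat \<Rightarrow> (nat \<Rightarrow> nat) \<Rightarrow> (nat + nat) ugraph" where
  "pendant_extension t a b f =
     \<lparr>verts = verts (complete_bipartite t b) \<union> Inl ` {t..<a},
      edges = edges (complete_bipartite t b) \<union> {{Inl i, Inr (f i)} | i. i \<in> {t..<a}}\<rparr>"

text \<open>
  For positive \<open>b\<close>, choosing another vertex than \<open>Inr 0\<close> as the common neighbour gives an
  isomorphic graph.
\<close>

definition B1_graph :: "nat \<Rightarrow> nat \<Rightarrow> nat \<Rightarrow> (nat + nat) ugraph" where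
  "B1_graph a b k = pendant_extension (t_par k) a b (\<lambda>_. 0)"

definition B1_family :: "nat \<Rightarrow> nat \<Rightarrow> nat \<Rightarrow> (nat + nat) ugraph set" where
  "B1_family a b k =
     {pendant_extension (t_par k) a b f | f. \<forall>i\<in>{t_par k..<a}. f i < b}"

end

theory Submission
  imports Defs
begin

text \<open>
  Put \<open>s = t + 2\<close>, so that \<open>k\<close> is \<open>2 s\<close> or \<open>2 s - 1\<close>; for everything except the position of the
  pendant vertices when \<open>k\<close> is odd, it is enough that there is no path on \<open>2 s\<close> vertices.
  Let \<open>P\<close> be a longest path. If its ends lie in different classes, the absence of a cycle through
  all of \<open>P\<close> gives two ends with degree sum at most \<open>t + 1\<close>. If both lie in \<open>A\<close>, then \<open>B\<close> has the
  majority outside \<open>P\<close>, so a depth-first search outside \<open>P\<close> has a leaf \<open>z\<close> in \<open>B\<close>, and a chord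
  argument shows that the degrees of \<open>z\<close> and of an end of \<open>P\<close> add up to at most \<open>t + 1\<close>. If both lie
  in \<open>B\<close>, an end of \<open>P\<close> has degree at most \<open>t\<close>. Hence for \<open>a < b\<close> a non-cut vertex of \<open>B\<close> of degree
  at most \<open>t\<close> can be deleted, and for \<open>a = b > s\<close> a pair of vertices with degree sum at most
  \<open>t + 1\<close>; both deletions match the decrease of the bound. In the remaining case \<open>a = b = s\<close>
  the rotations of Posa at ends of maximal degree produce many ends of small degree. They account
  for all but one of \<open>2 (s - 1)\<close> non-adjacent pairs when the ends of \<open>P\<close> lie in different classes;
  the last one comes from inserting vertices outside \<open>P\<close> into \<open>P\<close>.
\<close>

section \<open>Paths and connectivity\<close>

lemma last_take_Suc: "i < length P \<Longrightarrow> last (take (Suc i) P) = P ! i"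
  by (simp add: take_Suc_conv_app_nth)

lemma hd_take_Suc: "hd (take (Suc i) P) = hd P"
  by (cases P) auto

lemma hd_butlast: "2 \<le> length P \<Longrightarrow> hd (butlast P) = hd P"
  by (cases P) auto

locale sym_graph =
  fixes R :: "'a \<Rightarrow> 'a \<Rightarrow> bool"
  assumes sym: "R x y \<Longrightarrow> R y x"
    and irrefl: "\<not> R x x"
begin

lemma commute: "R x y \<longleftrightarrow> R y x"
  using sym by blast

definition nbrs :: "'a set \<Rightarrow> 'a \<Rightarrow> 'a set" where
  "nbrs X v = {u \<in> X. R v u}"

definition is_path :: "'a set \<Rightarrow> 'a list \<Rightarrow> bool" where
  "is_path X P \<longleftrightarrow> P \<noteq> [] \<and> distinct P \<and> set P \<subseteq> X \<and> successively R P"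

definition longest_path :: "'a set \<Rightarrow> 'a list \<Rightarrow> bool" where
  "longest_path X P \<longleftrightarrow> is_path X P \<and> (\<forall>Q. is_path X Q \<longrightarrow> length Q \<le> length P)"

definition reach :: "'a set \<Rightarrow> 'a \<Rightarrow> 'a \<Rightarrow> bool" where
  "reach X = (\<lambda>x y. R x y \<and> x \<in> X \<and> y \<in> X)\<^sup>*\<^sup>*"

definition conn :: "'a set \<Rightarrow> bool" where
  "conn X \<longleftrightarrow> (\<forall>u\<in>X. \<forall>v\<in>X. reach X u v)"

definition component :: "'a set \<Rightarrow> 'a \<Rightarrow> 'a set" where
  "component X v = {u \<in> X. reach X v u}"

lemma in_nbrs_iff [simp]: "u \<in> nbrs X v \<longleftrightarrow> u \<in> X \<and> R v u"
  by (simp add: nbrs_def)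

lemma finite_nbrs [simp]: "finite X \<Longrightarrow> finite (nbrs X v)"
  by (simp add: nbrs_def)

lemma card_nbrs_le: "finite X \<Longrightarrow> card (nbrs X v) \<le> card X"
  by (rule card_mono) auto

subsection \<open>Paths\<close>

lemma is_path_append_iff:
  assumes "P \<noteq> []" "Q \<noteq> []"
  shows "is_path X (P @ Q) \<longleftrightarrow>
    is_path X P \<and> is_path X Q \<and> set P \<inter> set Q = {} \<and> R (last P) (hd Q)"
  using assms by (auto simp: is_path_def successively_append_iff)

lemma is_path_append:
  assumes "is_path X P" "is_path X Q" "set P \<inter> set Q = {}" "R (last P) (hd Q)"
  shows "is_path X (P @ Q)"
  using assms is_path_append_iff by (auto simp: is_path_def)

lemma is_path_singleton: "v \<in> X \<Longrightarrow> is_path X [v]"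
  by (simp add: is_path_def)

lemma is_path_Cons:
  assumes "is_path X P" "v \<in> X" "v \<notin> set P" "R v (hd P)"
  shows "is_path X (v # P)"
  using is_path_append[of X "[v]" P] assms by (simp add: is_path_singleton)

lemma is_path_rev: "is_path X P \<Longrightarrow> is_path X (rev P)"
  unfolding is_path_def by (auto intro: successively_mono[of R] simp: sym)

lemma is_path_mono: "is_path X P \<Longrightarrow> X \<subseteq> Y \<Longrightarrow> is_path Y P"
  by (auto simp: is_path_def)

lemma is_path_take:
  assumes "is_path X P" "0 < n"
  shows "is_path X (take n P)"
proof (cases "n < length P")
  case True
  then show ?thesis
    using assms is_path_append_iff[of "take n P" "drop n P" X] by fastforce
qed (use assms in simp)

lemma is_path_drop:
  assumes "is_path X P" "n < length P"
  shows "is_path X (drop n P)"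
proof (cases "n = 0")
  case False
  then show ?thesis
    using assms is_path_append_iff[of "take n P" "drop n P" X] by fastforce
qed (use assms in simp)

lemma is_path_butlast:
  assumes "is_path X P" "2 \<le> length P"
  shows "is_path (X - {last P}) (butlast P)"
proof -
  obtain Q v where "P = Q @ [v]" using assms(2) by (cases P rule: rev_cases) auto
  moreover from this have "Q \<noteq> []" using assms(2) by auto
  ultimately show ?thesis
    using assms(1) is_path_append_iff[of Q "[v]" X] by (auto simp: is_path_def)
qed

lemma is_path_nth_Suc: "is_path X P \<Longrightarrow> Suc i < length P \<Longrightarrow> R (P ! i) (P ! Suc i)"
  by (simp add: is_path_def successively_conv_nth)

lemma is_path_nth_in: "is_path X P \<Longrightarrow> i < length P \<Longrightarrow> P ! i \<in> X"
  by (auto simp: is_path_def)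

lemma is_path_nth_eq_iff:
  "is_path X P \<Longrightarrow> i < length P \<Longrightarrow> j < length P \<Longrightarrow> P ! i = P ! j \<longleftrightarrow> i = j"
  by (simp add: is_path_def nth_eq_iff_index_eq)

lemma is_path_hd_last:
  assumes "is_path X P"
  shows "P \<noteq> []" "hd P \<in> set P" "last P \<in> set P" "hd P \<in> X" "last P \<in> X"
  using assms unfolding is_path_def by (meson hd_in_set last_in_set subsetD)+

lemma is_path_take_drop_disjoint:
  "is_path X P \<Longrightarrow> i \<le> j \<Longrightarrow> set (take i P) \<inter> set (drop j P) = {}"
  by (simp add: is_path_def set_take_disj_set_drop_if_distinct)

lemma is_path_length_le_card: "is_path X P \<Longrightarrow> finite X \<Longrightarrow> length P \<le> card X"
  by (metis card_mono distinct_card is_path_def)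

subsection \<open>Connectivity\<close>

lemma reach_refl [simp]: "reach X u u"
  by (simp add: reach_def)

lemma reach_trans: "reach X u v \<Longrightarrow> reach X v w \<Longrightarrow> reach X u w"
  by (simp add: reach_def)

lemma reach_edge: "R u v \<Longrightarrow> u \<in> X \<Longrightarrow> v \<in> X \<Longrightarrow> reach X u v"
  by (auto simp: reach_def)

lemma reach_sym: "reach X u v \<Longrightarrow> reach X v u"
  unfolding reach_def
  by (rule sympD[OF symp_rtranclp]) (auto intro!: sympI dest: sym)

lemma reach_mono:
  assumes "reach X u v" "X \<subseteq> Y"
  shows "reach Y u v"
proof -
  have "(\<lambda>x y. R x y \<and> x \<in> X \<and> y \<in> X) \<le> (\<lambda>x y. R x y \<and> x \<in> Y \<and> y \<in> Y)"
    using assms(2) by auto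
  from rtranclp_mono[OF this] show ?thesis using assms(1) by (auto simp: reach_def)
qed

lemma conn_if_reach_all:
  assumes "\<And>v. v \<in> X \<Longrightarrow> reach X r v"
  shows "conn X"
  unfolding conn_def using assms reach_sym reach_trans by blast

lemma conn_nbrs_nonempty:
  assumes "conn X" "v \<in> X" "w \<in> X" "v \<noteq> w"
  shows "nbrs X v \<noteq> {}"
proof -
  have "reach X v w" using assms by (simp add: conn_def)
  then show ?thesis
    using assms(4) unfolding reach_def by (cases rule: converse_rtranclpE) auto
qed

lemma conn_set_path:
  assumes "is_path X P"
  shows "conn (set P)"
proof (rule conn_if_reach_all)
  have "reach (set P) (P ! 0) (P ! i)" if "i < length P" for i
    using that
  proof (induction i)
    case (Suc i)
    have "reach (set P) (P ! i) (P ! Suc i)"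
      using is_path_nth_Suc[OF assms Suc.prems] Suc.prems by (intro reach_edge) auto
    then show ?case using Suc reach_trans by (meson Suc_lessD)
  qed simp
  then show "reach (set P) (P ! 0) v" if "v \<in> set P" for v
    using that by (metis in_set_conv_nth)
qed

lemma conn_Un:
  assumes "conn X" "conn Y" "u \<in> X" "v \<in> Y" "R u v"
  shows "conn (X \<union> Y)"
proof (rule conn_if_reach_all[of _ u])
  fix w assume "w \<in> X \<union> Y"
  moreover have "reach (X \<union> Y) u v" using assms by (intro reach_edge) auto
  moreover have "reach (X \<union> Y) u w" if "w \<in> X"
    using assms that by (auto simp: conn_def intro: reach_mono[of X])
  moreover have "reach (X \<union> Y) v w" if "w \<in> Y"
    using assms that by (auto simp: conn_def intro: reach_mono[of Y])
  ultimately show "reach (X \<union> Y) u w" using reach_trans by blast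
qed

lemma conn_remove:
  assumes "conn X" and C: "conn C" "C \<noteq> {}" "C \<subseteq> X - {x}" and nbrs_C: "nbrs X x \<subseteq> C"
  shows "conn (X - {x})"
proof -
  obtain c where "c \<in> C" using C by blast
  have reach_C: "reach (X - {x}) c w" if "w \<in> C" for w
    using C \<open>c \<in> C\<close> that by (auto simp: conn_def intro: reach_mono)
  have "w \<noteq> x \<longrightarrow> reach (X - {x}) c w" if "reach X c w" for w
    using that unfolding reach_def[of X]
  proof (induction rule: rtranclp_induct)
    case (step v w)
    show ?case
    proof (cases "v = x")
      case True
      then have "w \<in> C" using step nbrs_C by auto
      then show ?thesis using reach_C by blast
    next
      case False
      then show ?thesis
        using step by (meson DiffI reach_edge reach_trans singletonD)
    qed
  qed simp
  then show ?thesis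
    using \<open>conn X\<close> C \<open>c \<in> C\<close> by (intro conn_if_reach_all[of _ c]) (auto simp: conn_def)
qed

lemma conn_remove_last:
  assumes "conn X" "is_path X P" "2 \<le> length P" "nbrs X (last P) \<subseteq> set P"
  shows "conn (X - {last P})"
proof (rule conn_remove[OF assms(1)])
  note butlast = is_path_butlast[OF assms(2,3)]
  show "conn (set (butlast P))" using butlast by (rule conn_set_path)
  show "set (butlast P) \<noteq> {}" "set (butlast P) \<subseteq> X - {last P}"
    using butlast by (auto simp: is_path_def)
  have "set P = insert (last P) (set (butlast P))"
    using assms(2) by (cases P rule: rev_cases) (auto simp: is_path_def)
  then show "nbrs X (last P) \<subseteq> set (butlast P)"
    using assms(4) irrefl by auto
qed

lemma conn_remove_hd:
  assumes "conn X" "is_path X P" "2 \<le> length P" "nbrs X (hd P) \<subseteq> set P"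
  shows "conn (X - {hd P})"
  using conn_remove_last[of X "rev P"] assms by (simp add: is_path_rev last_rev)

lemma conn_remove_both_ends:
  assumes "conn X" "is_path X P" "3 \<le> length P"
    and "nbrs X (hd P) \<subseteq> set P" "nbrs X (last P) \<subseteq> set P"
  shows "conn (X - {last P} - {hd P})"
proof -
  have set_P: "set P = insert (last P) (set (butlast P))"
    using assms(3) by (cases P rule: rev_cases) auto
  have hd: "hd (butlast P) = hd P" using assms(3) by (intro hd_butlast) simp
  have "conn (X - {last P} - {hd (butlast P)})"
  proof (rule conn_remove_hd)
    show "conn (X - {last P})" using assms by (intro conn_remove_last) auto
    show "is_path (X - {last P}) (butlast P)" using assms by (intro is_path_butlast) auto
    show "nbrs (X - {last P}) (hd (butlast P)) \<subseteq> set (butlast P)"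
      using assms(4) unfolding hd set_P by auto
  qed (use assms(3) in simp)
  then show ?thesis by (simp add: hd)
qed

subsection \<open>Components\<close>

lemma component_self: "v \<in> X \<Longrightarrow> v \<in> component X v"
  by (simp add: component_def)

lemma component_subset: "component X v \<subseteq> X"
  by (auto simp: component_def)

lemma component_eq: "w \<in> component X v \<Longrightarrow> component X w = component X v"
  unfolding component_def by (auto dest: reach_sym intro: reach_trans)

lemma component_nbr: "u \<in> component X v \<Longrightarrow> w \<in> X \<Longrightarrow> R u w \<Longrightarrow> w \<in> component X v"
  unfolding component_def by (auto intro: reach_trans reach_edge)

lemma conn_component:
  assumes "v \<in> X"
  shows "conn (component X v)"
proof (rule conn_if_reach_all)
  fix w assume "w \<in> component X v"
  then have "reach X v w" by (simp add: component_def)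
  then show "reach (component X v) v w"
    unfolding reach_def[of X]
  proof (induction rule: rtranclp_induct)
    case (step y z)
    have "y \<in> component X v" using step assms by (simp add: component_def reach_def)
    then show ?case using step component_nbr reach_edge reach_trans by metis
  qed simp
qed

lemma component_exit:
  assumes "reach X v w" "v \<in> U" "w \<notin> U"
  obtains u u' where "u \<in> component U v" "u' \<in> X - U" "R u u'"
proof -
  have "w \<in> component U v \<or> (\<exists>u\<in>component U v. \<exists>u'\<in>X - U. R u u')"
    using assms(1) unfolding reach_def
  proof (induction rule: rtranclp_induct)
    case base
    then show ?case using component_self[OF assms(2)] by blast
  next
    case (step y z)
    then show ?case using component_nbr[of y U v z] by blast
  qed
  then show ?thesis using that assms(3) component_subset by blast
qed

lemma card_Int_eq_sum_components:
  assumes "finite X"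
  shows "card (X \<inter> Y) = (\<Sum>D\<in>component X ` X. card (D \<inter> Y))"
proof -
  have "X \<inter> Y = (\<Union>D\<in>component X ` X. D \<inter> Y)"
    using component_self component_subset by fastforce
  also have "card \<dots> = (\<Sum>D\<in>component X ` X. card (D \<inter> Y))"
  proof (rule card_UN_disjoint)
    show "\<forall>D\<in>component X ` X. finite (D \<inter> Y)"
      using assms component_subset finite_subset by blast
    show "\<forall>D\<in>component X ` X. \<forall>D'\<in>component X ` X. D \<noteq> D' \<longrightarrow> D \<inter> Y \<inter> (D' \<inter> Y) = {}"
      using component_eq by blast
  qed (use assms in simp)
  finally show ?thesis .
qed

lemma component_majority:
  fixes \<delta> :: nat
  assumes "finite X" "X \<noteq> {}" "\<delta> \<le> 1" and majority: "card (X \<inter> A) + \<delta> \<le> card (X \<inter> B)"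
  obtains v where "v \<in> X" "card (component X v \<inter> A) + \<delta> \<le> card (component X v \<inter> B)"
proof -
  have "\<not> (\<forall>v\<in>X. card (component X v \<inter> B) < card (component X v \<inter> A) + \<delta>)"
  proof
    assume minority: "\<forall>v\<in>X. card (component X v \<inter> B) < card (component X v \<inter> A) + \<delta>"
    show False
    proof (cases "\<delta> = 0")
      case True
      then have "card (X \<inter> B) < card (X \<inter> A)"
        unfolding card_Int_eq_sum_components[OF assms(1)]
        using assms(1,2) minority by (intro sum_strict_mono) auto
      then show False using majority by simp
    next
      case False
      then have "card (X \<inter> B) \<le> card (X \<inter> A)"
        unfolding card_Int_eq_sum_components[OF assms(1)]
        using assms(3) minority by (intro sum_mono) auto
      then show False using majority False by simp
    qed
  qed
  then show ?thesis using that by (meson not_le)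
qed

subsection \<open>Longest paths\<close>

lemma longest_path_is_path: "longest_path X P \<Longrightarrow> is_path X P"
  by (simp add: longest_path_def)

lemma longest_path_length_ge: "longest_path X P \<Longrightarrow> is_path X Q \<Longrightarrow> length Q \<le> length P"
  by (simp add: longest_path_def)

lemma longest_path_rev: "longest_path X P \<Longrightarrow> longest_path X (rev P)"
  by (simp add: longest_path_def is_path_rev)

lemma longest_path_exists:
  assumes "finite X" "X \<noteq> {}"
  obtains P where "longest_path X P"
proof -
  obtain v where "v \<in> X" using assms by blast
  then have "is_path X [v]" by (rule is_path_singleton)
  moreover have "\<forall>P. is_path X P \<longrightarrow> length P < Suc (card X)"
    using assms(1) is_path_length_le_card by (simp add: less_Suc_eq_le)
  ultimately show ?thesis
    using ex_has_greatest_nat[of "is_path X" "[v]" length] that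
    by (auto simp: longest_path_def less_imp_le)
qed

lemma longest_path_maximizing:
  fixes w :: "'a list \<Rightarrow> nat"
  assumes "finite X" "longest_path X P" "good P"
  obtains P' where "longest_path X P'" "good P'"
    "\<And>Q. longest_path X Q \<Longrightarrow> good Q \<Longrightarrow> w Q \<le> w P'"
proof -
  let ?S = "{Q. longest_path X Q \<and> good Q}"
  have "finite {Q. set Q \<subseteq> X \<and> distinct Q}"
    using assms(1) by (rule finite_subset_distinct)
  then have fin: "finite ?S"
    by (rule rev_finite_subset) (auto simp: longest_path_def is_path_def)
  moreover have "?S \<noteq> {}" using assms by auto
  ultimately obtain P' where "P' \<in> ?S" "w P' = Max (w ` ?S)"
    using Max_in[of "w ` ?S"] by fastforce
  moreover have "w Q \<le> Max (w ` ?S)" if "longest_path X Q" "good Q" for Q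
    using fin that by (intro Max_ge) auto
  ultimately show ?thesis using that by auto
qed

lemma longest_path_nbrs_hd:
  assumes "longest_path X P"
  shows "nbrs X (hd P) \<subseteq> set P"
proof
  fix w assume w: "w \<in> nbrs X (hd P)"
  show "w \<in> set P"
  proof (rule ccontr)
    assume "w \<notin> set P"
    then have "is_path X (w # P)"
      using assms w by (intro is_path_Cons) (auto simp: longest_path_def sym)
    from longest_path_length_ge[OF assms this] show False by simp
  qed
qed

lemma longest_path_nbrs_last: "longest_path X P \<Longrightarrow> nbrs X (last P) \<subseteq> set P"
  using longest_path_nbrs_hd[OF longest_path_rev, of X P] by (simp add: hd_rev)

subsection \<open>Tails and rotations\<close>

definition attached :: "'a set \<Rightarrow> 'a list \<Rightarrow> nat \<Rightarrow> 'a list \<Rightarrow> bool" where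
  "attached X P i Q \<longleftrightarrow> is_path (X - set P) Q \<and> i < length P \<and> R (P ! i) (hd Q)"

definition nbr_positions :: "'a list \<Rightarrow> 'a \<Rightarrow> nat set" where
  "nbr_positions P v = {i. i < length P \<and> R v (P ! i)}"

definition rotation_heads :: "'a list \<Rightarrow> 'a set" where
  "rotation_heads P = {P ! i | i. Suc i \<in> nbr_positions P (hd P)}"

lemma attached_disjoint: "attached X P i Q \<Longrightarrow> set P \<inter> set Q = {}"
  by (auto simp: attached_def is_path_def)

lemma attached_singleton_iff:
  "attached X P i [v] \<longleftrightarrow> v \<in> X - set P \<and> i < length P \<and> R (P ! i) v"
  by (auto simp: attached_def is_path_def)

lemma attached_singleton_rev:
  "attached X P i [v] \<Longrightarrow> attached X (rev P) (length P - Suc i) [v]"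
  by (auto simp: attached_singleton_iff rev_nth)

lemma is_path_attached:
  assumes "is_path X P" "attached X P i Q"
  shows "is_path X (take (Suc i) P @ Q)"
proof (rule is_path_append)
  show "is_path X (take (Suc i) P)" using assms(1) by (rule is_path_take) simp
  show "is_path X Q" using assms(2) by (auto simp: attached_def intro: is_path_mono)
  show "set (take (Suc i) P) \<inter> set Q = {}"
    using attached_disjoint[OF assms(2)] set_take_subset[of "Suc i" P] by auto
  show "R (last (take (Suc i) P)) (hd Q)"
    using assms(2) by (simp add: attached_def last_take_Suc)
qed

lemma attached_exists:
  assumes "conn X" "is_path X P" "u \<in> X - set P"
  obtains r i where "r \<in> component (X - set P) u" "attached X P i [r]"
proof -
  have "reach X u (hd P)" "hd P \<notin> X - set P"
    using assms is_path_hd_last[OF assms(2)] by (auto simp: conn_def)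
  then obtain r p where "r \<in> component (X - set P) u" "p \<in> set P" "R r p"
    using component_exit[OF _ assms(3)] by blast
  moreover from this obtain i where "i < length P" "p = P ! i" by (metis in_set_conv_nth)
  ultimately have "attached X P i [r]"
    using component_subset[of "X - set P" u] sym by (auto simp: attached_singleton_iff)
  then show ?thesis using that \<open>r \<in> component (X - set P) u\<close> by blast
qed

lemma conn_remove_attached_last:
  assumes "conn X" "is_path X P" "attached X P i Q" and nbrs_Q: "nbrs X (last Q) \<subseteq> set P \<union> set Q"
  shows "conn (X - {last Q})"
proof (rule conn_remove[OF assms(1)])
  have Q: "is_path (X - set P) Q" "R (P ! i) (hd Q)" "i < length P"
    using assms(3) by (auto simp: attached_def)
  have "Q = butlast Q @ [last Q]" using is_path_hd_last(1)[OF Q(1)] by simp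
  then have set_Q: "set Q = insert (last Q) (set (butlast Q))"
    by (metis Un_insert_right list.set set_append sup_bot_right)
  show "conn (set P \<union> set (butlast Q))"
  proof (cases "2 \<le> length Q")
    case True
    then have "is_path (X - set P) (butlast Q)" "hd (butlast Q) = hd Q"
      using is_path_mono[OF is_path_butlast[OF Q(1)]] by (auto simp: hd_butlast)
    then show ?thesis
      using assms(2) Q(2,3) by (intro conn_Un[of _ _ "P ! i" "hd Q"] conn_set_path)
        (auto simp: is_path_def dest: hd_in_set)
  next
    case False
    then have "butlast Q = []" by (cases Q) (auto simp: Suc_le_eq)
    then show ?thesis using conn_set_path[OF assms(2)] by simp
  qed
  show "set P \<union> set (butlast Q) \<noteq> {}" using is_path_hd_last(1)[OF assms(2)] by simp
  have "last Q \<notin> set (butlast Q)"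
    using Q(1) by (cases Q rule: rev_cases) (auto simp: is_path_def)
  then show "set P \<union> set (butlast Q) \<subseteq> X - {last Q}"
    using assms(2) Q(1) set_Q by (auto simp: is_path_def)
  show "nbrs X (last Q) \<subseteq> set P \<union> set (butlast Q)" using nbrs_Q set_Q irrefl by auto
qed

lemma longest_path_conn_remove_hd:
  assumes "conn X" "longest_path X P"
  shows "conn (X - {hd P})"
proof (cases "2 \<le> length P")
  case True
  then show ?thesis
    using assms longest_path_is_path longest_path_nbrs_hd by (intro conn_remove_hd) auto
next
  case False
  have P: "is_path X P" using assms(2) by (rule longest_path_is_path)
  then have "P = [hd P]"
    using False by (cases P) (auto simp: is_path_def Suc_le_eq)
  then have "set P = {hd P}" by (metis list.set)
  then have "nbrs X (hd P) = {}" using longest_path_nbrs_hd[OF assms(2)] irrefl by auto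
  then have "X - {hd P} = {}"
    using conn_nbrs_nonempty[OF assms(1)] is_path_hd_last(4)[OF P] by blast
  then show ?thesis unfolding conn_def by blast
qed

lemma longest_path_bypass_le:
  assumes "longest_path X P" "is_path X M" "set M \<inter> set (drop j P) = {}"
    and "j < length P" "R (last M) (P ! j)"
  shows "length M \<le> j"
proof -
  have "is_path X (M @ drop j P)"
    using assms longest_path_is_path
    by (intro is_path_append is_path_drop) (auto simp: hd_drop_conv_nth)
  from longest_path_length_ge[OF assms(1) this] show ?thesis using assms(4) by simp
qed

lemma longest_path_attached_length:
  assumes "longest_path X P" "attached X P i Q"
  shows "i + length Q < length P"
  using longest_path_length_ge[OF assms(1) is_path_attached] assms longest_path_is_path
  by (fastforce simp: attached_def)

lemma attached_disjoint_drop: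
  assumes "is_path X P" "attached X P i Q" "i < j"
  shows "set (take (Suc i) P @ Q) \<inter> set (drop j P) = {}"
  using is_path_take_drop_disjoint[OF assms(1), of "Suc i" j] attached_disjoint[OF assms(2)]
    set_drop_subset[of j P] assms(3) by auto

lemma longest_path_attached_twice:
  assumes "longest_path X P" "attached X P i Q" and j: "i < j" "j < length P" "R (last Q) (P ! j)"
  shows "i + length Q < j"
proof -
  have "Q \<noteq> []" using assms(2) by (auto simp: attached_def is_path_def)
  then have "length (take (Suc i) P @ Q) \<le> j"
    using assms longest_path_is_path[OF assms(1)]
    by (intro longest_path_bypass_le[OF assms(1)] is_path_attached attached_disjoint_drop) auto
  then show ?thesis using j by simp
qed

lemma longest_path_attached_chord:
  assumes "longest_path X P" "attached X P i Q" and j: "i < j" "j \<in> nbr_positions P (hd P)"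
  shows "i + length Q < j"
proof -
  have P: "is_path X P" using assms(1) by (rule longest_path_is_path)
  have "hd (take (Suc i) P @ Q) = hd P"
    using is_path_hd_last(1)[OF P] by (simp add: hd_append hd_take_Suc)
  then have "length (rev (take (Suc i) P @ Q)) \<le> j"
    using j is_path_attached[OF P assms(2)] attached_disjoint_drop[OF P assms(2) j(1)]
    by (intro longest_path_bypass_le[OF assms(1)])
      (auto simp: nbr_positions_def last_rev is_path_rev simp del: rev_append)
  then show ?thesis using j by (simp add: nbr_positions_def)
qed

lemma longest_path_no_spanning_cycle:
  assumes "longest_path X P" "conn X" "set P \<noteq> X"
  shows "\<not> R (last P) (hd P)"
proof
  assume closing: "R (last P) (hd P)"
  have P: "is_path X P" using assms(1) by (rule longest_path_is_path)
  then obtain u where "u \<in> X - set P" using assms(3) by (auto simp: is_path_def)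
  then obtain r m where r: "attached X P m [r]" using attached_exists[OF assms(2) P] by metis
  then have m: "Suc m < length P" using longest_path_attached_length[OF assms(1)] by fastforce
  have "is_path X (drop (Suc m) P @ take (Suc m) P @ [r])"
  proof (rule is_path_append)
    show "is_path X (drop (Suc m) P)" using P m by (rule is_path_drop)
    show "is_path X (take (Suc m) P @ [r])" using P r by (rule is_path_attached)
    show "set (drop (Suc m) P) \<inter> set (take (Suc m) P @ [r]) = {}"
      using attached_disjoint_drop[OF P r, of "Suc m"] by blast
    have "hd (take (Suc m) P @ [r]) = hd P"
      using is_path_hd_last(1)[OF P] by (simp add: hd_append hd_take_Suc)
    then show "R (last (drop (Suc m) P)) (hd (take (Suc m) P @ [r]))"
      using closing m by simp
  qed
  from longest_path_length_ge[OF assms(1) this] show False by simp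
qed

lemma longest_path_detour:
  assumes "longest_path X P" and v: "attached X P i [v]"
    and chords: "i + 3 \<in> nbr_positions P (hd P)" "i + 1 \<in> nbr_positions P (last P)"
  shows False
proof -
  have P: "is_path X P" using assms(1) by (rule longest_path_is_path)
  have i: "i + 3 < length P" "R (hd P) (P ! (i + 3))" "R (last P) (P ! (i + 1))"
    using chords by (auto simp: nbr_positions_def)
  let ?S = "take (Suc i) P" and ?M = "take 2 (drop (Suc i) P)" and ?D = "drop (i + 3) P"
  have "P = ?S @ ?M @ ?D"
    using append_take_drop_id[of 2 "drop (Suc i) P"] by (simp add: numeral_3_eq_3)
  then have "distinct (?S @ ?M @ ?D)" "set P = set ?S \<union> set ?M \<union> set ?D"
    using P by (auto simp: is_path_def simp del: append_take_drop_id) (metis set_append Un_iff)+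
  then have disjoint: "set ?S \<inter> set ?M = {}" "set ?S \<inter> set ?D = {}" "set ?M \<inter> set ?D = {}"
    "v \<notin> set ?S" "v \<notin> set ?M" "v \<notin> set ?D"
    using attached_disjoint[OF v] by auto
  have "hd (?S @ [v]) = hd P"
    using is_path_hd_last(1)[OF P] by (simp add: hd_append hd_take_Suc)
  then have "is_path X (rev (?S @ [v]) @ ?D)"
    using i P v disjoint by (intro is_path_append is_path_rev is_path_attached is_path_drop)
      (auto simp: last_rev hd_drop_conv_nth simp del: rev_append)
  then have "is_path X ((rev (?S @ [v]) @ ?D) @ ?M)"
    using i P disjoint
    by (intro is_path_append[of _ "rev (?S @ [v]) @ ?D"] is_path_take[OF is_path_drop])
      (auto simp: hd_drop_conv_nth)
  from longest_path_length_ge[OF assms(1) this] i show False by simp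
qed

lemma in_nbr_positions_rev_iff:
  "i < length P \<Longrightarrow> length P - Suc i \<in> nbr_positions (rev P) v \<longleftrightarrow> i \<in> nbr_positions P v"
  by (auto simp: nbr_positions_def rev_nth)

lemma card_nbr_positions:
  assumes "is_path X P"
  shows "card (nbr_positions P v) = card (nbrs (set P) v)"
proof -
  have "nbrs (set P) v = (!) P ` nbr_positions P v"
    by (auto simp: nbr_positions_def in_set_conv_nth)
  moreover have "inj_on ((!) P) (nbr_positions P v)"
    using assms by (auto simp: inj_on_def nbr_positions_def is_path_nth_eq_iff)
  ultimately show ?thesis by (simp add: card_image)
qed

lemma card_nbr_positions_eq:
  assumes "is_path X P" "nbrs X v \<subseteq> set P"
  shows "card (nbr_positions P v) = card (nbrs X v)"
proof -
  have "nbrs X v = nbrs (set P) v" using assms by (auto simp: is_path_def)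
  then show ?thesis using card_nbr_positions[OF assms(1)] by simp
qed

lemma finite_nbr_positions [simp]: "finite (nbr_positions P v)"
  by (simp add: nbr_positions_def)

lemma zero_notin_nbr_positions_hd: "P \<noteq> [] \<Longrightarrow> 0 \<notin> nbr_positions P (hd P)"
  by (simp add: nbr_positions_def hd_conv_nth irrefl)

lemma nbr_positions_last_less: "i \<in> nbr_positions P (last P) \<Longrightarrow> Suc i < length P"
  by (cases P rule: rev_cases) (auto simp: nbr_positions_def nth_append irrefl split: if_splits)

lemma card_nbrs_attached_last_le:
  assumes "longest_path X P" "attached X P i Q" "nbrs X (last Q) \<subseteq> set P \<union> set Q"
  shows "card (nbrs X (last Q)) \<le>
    card (Suc ` nbr_positions P (last Q) \<union> (\<lambda>m. i + m + 2) ` nbr_positions Q (last Q))"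
    (is "_ \<le> card (?J \<union> ?K)")
proof -
  have P: "is_path X P" and Q: "is_path (X - set P) Q"
    using assms(1,2) longest_path_is_path by (auto simp: attached_def)
  have "nbrs X (last Q) = nbrs (set P) (last Q) \<union> nbrs (set Q) (last Q)"
    using assms(3) P Q by (auto simp: is_path_def)
  then have "card (nbrs X (last Q)) \<le>
      card (nbr_positions P (last Q)) + card (nbr_positions Q (last Q))"
    using card_Un_le[of "nbrs (set P) (last Q)" "nbrs (set Q) (last Q)"]
      card_nbr_positions[OF P] card_nbr_positions[OF Q] by simp
  also have "\<dots> = card ?J + card ?K" by (simp add: card_image inj_on_def)
  also have "\<dots> = card (?J \<union> ?K)"
  proof (rule card_Un_disjoint[symmetric])
    have False if "i + m + 1 \<in> nbr_positions P (last Q)" "m \<in> nbr_positions Q (last Q)" for m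
      using longest_path_attached_twice[OF assms(1,2), of "i + m + 1"] that
        nbr_positions_last_less[OF that(2)] by (simp add: nbr_positions_def)
    then show "?J \<inter> ?K = {}" by auto
  qed auto
  finally show ?thesis .
qed

lemma rotation_heads_subset: "rotation_heads P \<subseteq> set P"
  by (auto simp: rotation_heads_def nbr_positions_def)

lemma hd_in_rotation_heads:
  assumes "is_path X P" "2 \<le> length P"
  shows "hd P \<in> rotation_heads P"
proof -
  have "hd P = P ! 0" using is_path_hd_last(1)[OF assms(1)] by (simp add: hd_conv_nth)
  moreover have "Suc 0 \<in> nbr_positions P (hd P)"
    using is_path_nth_Suc[OF assms(1), of 0] assms(2) calculation by (simp add: nbr_positions_def)
  ultimately show ?thesis unfolding rotation_heads_def by blast
qed

lemma nth_in_rotation_heads_iff: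
  assumes "is_path X P" "i < length P"
  shows "P ! i \<in> rotation_heads P \<longleftrightarrow> Suc i \<in> nbr_positions P (hd P)"
proof
  assume "P ! i \<in> rotation_heads P"
  then obtain j where "P ! i = P ! j" "Suc j \<in> nbr_positions P (hd P)"
    by (auto simp: rotation_heads_def)
  moreover from this have "i = j"
    using is_path_nth_eq_iff[OF assms, of j] by (simp add: nbr_positions_def)
  ultimately show "Suc i \<in> nbr_positions P (hd P)" by simp
qed (auto simp: rotation_heads_def)

lemma nth_Suc_in_rotation_heads_rev_iff:
  assumes "is_path X P" "Suc i < length P"
  shows "P ! Suc i \<in> rotation_heads (rev P) \<longleftrightarrow> i \<in> nbr_positions P (last P)"
proof -
  let ?j = "length P - Suc (Suc i)"
  have "P ! Suc i \<in> rotation_heads (rev P) \<longleftrightarrow> Suc ?j \<in> nbr_positions (rev P) (hd (rev P))"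
    using nth_in_rotation_heads_iff[OF is_path_rev[OF assms(1)], of ?j] assms(2)
    by (simp add: rev_nth)
  also have "Suc ?j = length P - Suc i" using assms(2) by simp
  also have "\<dots> \<in> nbr_positions (rev P) (hd (rev P)) \<longleftrightarrow> i \<in> nbr_positions P (last P)"
    using in_nbr_positions_rev_iff[of i P "last P"] assms(2) by (simp add: hd_rev)
  finally show ?thesis .
qed

lemma card_rotation_heads:
  assumes "longest_path X P"
  shows "card (rotation_heads P) = card (nbrs X (hd P))"
proof -
  have P: "is_path X P" using assms by (rule longest_path_is_path)
  let ?I = "{i. Suc i \<in> nbr_positions P (hd P)}"
  have "rotation_heads P = (!) P ` ?I" by (auto simp: rotation_heads_def)
  moreover have "inj_on ((!) P) ?I"
    using P by (auto simp: inj_on_def nbr_positions_def is_path_nth_eq_iff)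
  ultimately have "card (rotation_heads P) = card ?I" by (simp add: card_image)
  also have "\<dots> = card (Suc ` ?I)" by (simp add: card_image)
  also have "Suc ` ?I = nbr_positions P (hd P)"
    using zero_notin_nbr_positions_hd[OF is_path_hd_last(1)[OF P]]
    by (auto simp: image_iff) (metis not0_implies_Suc)
  finally show ?thesis using card_nbr_positions_eq[OF P longest_path_nbrs_hd[OF assms]] by simp
qed

lemma longest_path_rotation:
  assumes "longest_path X P" "u \<in> rotation_heads P"
  obtains P' where "longest_path X P'" "hd P' = u" "last P' = last P" "set P' = set P"
proof -
  have P: "is_path X P" using assms(1) by (rule longest_path_is_path)
  obtain i where i: "Suc i < length P" "R (hd P) (P ! Suc i)" "u = P ! i"
    using assms(2) by (auto simp: rotation_heads_def nbr_positions_def)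
  let ?P' = "rev (take (Suc i) P) @ drop (Suc i) P"
  have "is_path X ?P'"
    using P i is_path_take_drop_disjoint[OF P, of "Suc i" "Suc i"]
    by (intro is_path_append is_path_rev is_path_take is_path_drop)
      (auto simp: last_rev hd_take_Suc hd_drop_conv_nth)
  moreover have "length ?P' = length P" using i by simp
  ultimately have "longest_path X ?P'" using assms(1) unfolding longest_path_def by metis
  moreover have "P \<noteq> []" using i by auto
  then have "hd ?P' = u" using i by (simp add: hd_append hd_rev last_take_Suc)
  moreover have "last ?P' = last P" using i by simp
  moreover have "set ?P' = set P" by (metis append_take_drop_id set_append set_rev)
  ultimately show ?thesis by (rule that)
qed

lemma longest_path_no_crossing:
  assumes "longest_path X P" "conn X" "set P \<noteq> X" "i \<in> nbr_positions P (last P)"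
  shows "Suc i \<notin> nbr_positions P (hd P)"
proof -
  have "Suc i < length P" using assms(4) by (rule nbr_positions_last_less)
  then have "P ! Suc i \<in> rotation_heads (rev P)"
    using nth_Suc_in_rotation_heads_rev_iff longest_path_is_path assms(1,4) by blast
  then obtain P' where "longest_path X P'" "hd P' = P ! Suc i" "last P' = hd P" "set P' = set P"
    using longest_path_rotation[OF longest_path_rev[OF assms(1)]] by (metis last_rev set_rev)
  then show ?thesis
    using longest_path_no_spanning_cycle[of X P'] assms(2,3) by (auto simp: nbr_positions_def)
qed

end

section \<open>Bipartite graphs\<close>

lemma card_odd_less: "card {j. j < n \<and> odd j} = n div (2::nat)"
proof (induction n)
  case (Suc n)
  have "{j. j < Suc n \<and> odd j} =
      (if odd n then insert n {j. j < n \<and> odd j} else {j. j < n \<and> odd j})"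
    by (auto simp: less_Suc_eq)
  then show ?case using Suc by (auto elim!: oddE)
qed simp

lemma card_add_card_le_half:
  assumes "I \<subseteq> {j. j < n \<and> odd j}" "J \<subseteq> {j. j < n \<and> odd j}" "I \<inter> J = {}"
  shows "card I + card J \<le> n div (2::nat)"
proof -
  have "finite {j. j < n \<and> odd j}" by simp
  then have "card I + card J = card (I \<union> J)" "card (I \<union> J) \<le> card {j. j < n \<and> odd j}"
    using assms finite_subset by (intro card_Un_disjoint[symmetric] card_mono; blast)+
  then show ?thesis by (simp add: card_odd_less)
qed

locale bipartite = sym_graph R for R :: "'a \<Rightarrow> 'a \<Rightarrow> bool" +
  fixes V A B :: "'a set"
  assumes finite_A [simp]: "finite A" and finite_B [simp]: "finite B"
    and V_eq: "V = A \<union> B"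
    and disjoint: "A \<inter> B = {}"
    and indep_A: "x \<in> A \<Longrightarrow> y \<in> A \<Longrightarrow> \<not> R x y"
    and indep_B: "x \<in> B \<Longrightarrow> y \<in> B \<Longrightarrow> \<not> R x y"
begin

lemma finite_subset_A: "T \<subseteq> A \<Longrightarrow> finite T"
  using finite_A by (rule rev_finite_subset)

lemma bipartite_swap: "bipartite R V B A"
  by unfold_locales (use V_eq disjoint indep_A indep_B in auto)

sublocale swap: bipartite R V B A
  by (rule bipartite_swap)

lemma bipartite_subset:
  assumes "A' \<subseteq> A" "B' \<subseteq> B"
  shows "bipartite R (A' \<union> B') A' B'"
proof
  show "finite A'" using assms(1) by (rule finite_subset_A)
  show "finite B'" using assms(2) by (rule swap.finite_subset_A)
  show "A' \<inter> B' = {}" using assms disjoint by auto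
  show "\<not> R x y" if "x \<in> A'" "y \<in> A'" for x y using that assms indep_A by blast
  show "\<not> R x y" if "x \<in> B'" "y \<in> B'" for x y using that assms indep_B by blast
qed simp

lemma finite_V [simp]: "finite V"
  by (simp add: V_eq)

lemma in_B_iff: "v \<in> V \<Longrightarrow> v \<in> B \<longleftrightarrow> v \<notin> A"
  using V_eq disjoint by auto

lemma edge_in_A_iff: "R u v \<Longrightarrow> u \<in> V \<Longrightarrow> v \<in> V \<Longrightarrow> u \<in> A \<longleftrightarrow> v \<notin> A"
  using V_eq indep_A indep_B by blast

lemma nbrs_V_eq: "x \<in> A \<Longrightarrow> nbrs V x = nbrs B x"
  using indep_A V_eq by auto

lemma nbrs_B_nonempty:
  assumes "conn V" "x \<in> A" "B \<noteq> {}"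
  shows "nbrs B x \<noteq> {}"
proof -
  obtain y where "y \<in> B" "x \<noteq> y" using assms(2,3) disjoint by blast
  then show ?thesis
    using conn_nbrs_nonempty[OF assms(1), of x y] assms(2) V_eq nbrs_V_eq by auto
qed

lemma nth_in_A_iff:
  assumes "is_path V P" "hd P \<in> A" "j < length P"
  shows "P ! j \<in> A \<longleftrightarrow> even j"
  using assms(3)
proof (induction j)
  case 0
  then show ?case using assms(2) by (simp add: hd_conv_nth)
next
  case (Suc j)
  then show ?case
    using edge_in_A_iff[OF is_path_nth_Suc[OF assms(1) Suc.prems]] is_path_nth_in[OF assms(1)]
    by auto
qed

lemma nth_in_B_iff:
  "is_path V P \<Longrightarrow> hd P \<in> A \<Longrightarrow> j < length P \<Longrightarrow> P ! j \<in> B \<longleftrightarrow> odd j"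
  using nth_in_A_iff in_B_iff is_path_nth_in by blast

lemma last_in_A_iff:
  assumes "is_path V P" "hd P \<in> A"
  shows "last P \<in> A \<longleftrightarrow> odd (length P)"
  using nth_in_A_iff[OF assms, of "length P - 1"] is_path_hd_last(1)[OF assms(1)]
  by (auto simp: last_conv_nth)

lemma nbr_positions_odd:
  assumes "is_path V P" "hd P \<in> A" "v \<in> A"
  shows "nbr_positions P v \<subseteq> {j. j < length P \<and> odd j}"
  using nth_in_A_iff[OF assms(1,2)] indep_A[OF assms(3)] by (auto simp: nbr_positions_def)

lemma nbr_positions_even:
  assumes "is_path V P" "hd P \<in> A" "v \<in> B"
  shows "nbr_positions P v \<subseteq> {j. j < length P \<and> even j}"
  using nth_in_B_iff[OF assms(1,2)] indep_B[OF assms(3)] by (auto simp: nbr_positions_def)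

lemma rotation_heads_subset_A:
  assumes "is_path V P" "hd P \<in> A"
  shows "rotation_heads P \<subseteq> A"
  using nbr_positions_odd[OF assms assms(2)] nth_in_A_iff[OF assms]
  by (fastforce simp: rotation_heads_def)

lemma card_path_Int_B:
  assumes "is_path V P" "hd P \<in> A"
  shows "card (set P \<inter> B) = length P div 2"
proof -
  have "set P \<inter> B = (!) P ` {j. j < length P \<and> odd j}"
    using nth_in_B_iff[OF assms] by (auto simp: in_set_conv_nth intro!: imageI)
  moreover have "inj_on ((!) P) {j. j < length P \<and> odd j}"
    using assms(1) by (auto simp: inj_on_def is_path_nth_eq_iff)
  ultimately show ?thesis by (simp add: card_image card_odd_less)
qed

lemma card_path_Int_A:
  assumes "is_path V P" "hd P \<in> A"
  shows "card (set P \<inter> A) = length P - length P div 2"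
proof -
  have "set P = (set P \<inter> A) \<union> (set P \<inter> B)"
    using assms(1) V_eq by (auto simp: is_path_def)
  then have "card (set P) = card (set P \<inter> A) + card (set P \<inter> B)"
    using disjoint by (metis (no_types, lifting) card_Un_disjoint finite_Int finite_A finite_B
        Int_assoc Int_commute Int_empty_right)
  then show ?thesis
    using assms(1) card_path_Int_B[OF assms] by (simp add: is_path_def distinct_card)
qed

subsection \<open>Leaves of a depth-first search\<close>

lemma majority_remove_root:
  assumes "D \<subseteq> V" "r \<in> D" "card (D \<inter> A) + of_bool (r \<in> B) \<le> card (D \<inter> B)"
  shows "card ((D - {r}) \<inter> A) + of_bool (r \<in> A) \<le> card ((D - {r}) \<inter> B)"
proof (cases "r \<in> A")
  case True
  then have "(D - {r}) \<inter> A = D \<inter> A - {r}" "(D - {r}) \<inter> B = D \<inter> B" "r \<notin> B"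
    using disjoint by auto
  moreover have "card (D \<inter> A) > 0" using assms(2) True by (auto simp: card_gt_0_iff)
  ultimately show ?thesis using assms True by simp
next
  case False
  then have "(D - {r}) \<inter> A = D \<inter> A" "(D - {r}) \<inter> B = D \<inter> B - {r}" "r \<in> B"
    using assms in_B_iff by auto
  then show ?thesis using assms False by simp
qed

lemma dfs_descend:
  assumes "conn D" "D \<subseteq> V" "r \<in> D" "D \<noteq> {r}"
    and majority: "card (D \<inter> A) + of_bool (r \<in> B) \<le> card (D \<inter> B)"
  obtains v r' where "v \<in> D - {r}" "r' \<in> component (D - {r}) v" "R r r'"
    "card (component (D - {r}) v \<inter> A) + of_bool (r' \<in> B) \<le> card (component (D - {r}) v \<inter> B)"
proof -
  let ?U = "D - {r}"
  have "finite ?U" using assms(2) finite_V finite_subset by blast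
  moreover have "?U \<noteq> {}" using assms(3,4) by blast
  moreover have "of_bool (r \<in> A) \<le> (1::nat)" by simp
  moreover have "card (?U \<inter> A) + of_bool (r \<in> A) \<le> card (?U \<inter> B)"
    using assms(2,3) majority by (rule majority_remove_root)
  ultimately obtain v where v: "v \<in> ?U"
    and majority_v: "card (component ?U v \<inter> A) + of_bool (r \<in> A) \<le> card (component ?U v \<inter> B)"
    by (rule component_majority)
  have "reach D v r" "r \<notin> ?U" using assms(1,3) v by (auto simp: conn_def)
  then obtain r' where r': "r' \<in> component ?U v" "R r' r"
    using component_exit[OF _ v] by blast
  then have "r' \<in> D" using component_subset by blast
  then have "r' \<in> B \<longleftrightarrow> r \<in> A"
    using edge_in_A_iff[OF r'(2)] in_B_iff assms(2,3) by blast
  then show ?thesis using that[OF v r'(1) sym[OF r'(2)]] majority_v by simp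
qed

text \<open>
  The excess of \<open>B\<close> over \<open>A\<close>, strict if the root is in \<open>B\<close>, passes from the root of the search to
  one of its children; hence some branch ends in \<open>B\<close>.
\<close>

lemma dfs_leaf:
  assumes "conn D" "D \<subseteq> V" "r \<in> D" "card (D \<inter> A) + of_bool (r \<in> B) \<le> card (D \<inter> B)"
  obtains Q where "is_path D Q" "hd Q = r" "last Q \<in> B" "nbrs D (last Q) \<subseteq> set Q"
  using assms
proof (induction "card D" arbitrary: D r thesis rule: less_induct)
  case less
  show ?case
  proof (cases "D = {r}")
    case True
    then have "r \<in> B" using less.prems(3,5) V_eq by (cases "r \<in> B") auto
    then show ?thesis using less.prems(1)[of "[r]"] True by (auto simp: is_path_singleton nbrs_def)
  next
    case False
    then obtain v r' where v: "v \<in> D - {r}" and r': "r' \<in> component (D - {r}) v" "R r r'"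
      and majority: "card (component (D - {r}) v \<inter> A) + of_bool (r' \<in> B) \<le>
        card (component (D - {r}) v \<inter> B)"
      using dfs_descend[OF less.prems(2-4)] less.prems(5) by blast
    let ?C = "component (D - {r}) v"
    have C: "?C \<subseteq> D - {r}" by (rule component_subset)
    moreover have "finite D" using less.prems(3) finite_V by (rule finite_subset)
    ultimately have "card ?C < card D" using less.prems(4) by (intro psubset_card_mono) auto
    then obtain Q where Q: "is_path ?C Q" "hd Q = r'" "last Q \<in> B" "nbrs ?C (last Q) \<subseteq> set Q"
      using less.hyps[of ?C r'] conn_component[OF v] majority C less.prems(3) r'(1) by blast
    have "is_path D (r # Q)"
      using Q(1,2) C less.prems(4) r'(2) by (intro is_path_Cons) (auto simp: is_path_def)
    moreover have "nbrs D (last Q) \<subseteq> set (r # Q)"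
      using Q(4) component_nbr[OF is_path_hd_last(5)[OF Q(1)]]
      unfolding nbrs_def by (simp add: subset_iff) blast
    ultimately show ?thesis
      using less.prems(1)[of "r # Q"] Q(3) is_path_hd_last(1)[OF Q(1)] by auto
  qed
qed

lemma attached_leaf_exists:
  assumes "conn V" "is_path V P" and majority: "card (A - set P) < card (B - set P)"
  obtains i Q where "attached V P i Q" "last Q \<in> B" "nbrs V (last Q) \<subseteq> set P \<union> set Q"
proof -
  let ?U = "V - set P"
  have "?U \<inter> A = A - set P" "?U \<inter> B = B - set P" using V_eq by auto
  moreover have "B - set P \<noteq> {}" using majority by (metis card.empty not_less_zero)
  then have "?U \<noteq> {}" using V_eq by auto
  ultimately obtain v where v: "v \<in> ?U"
    and majority_v: "card (component ?U v \<inter> A) + 1 \<le> card (component ?U v \<inter> B)"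
    using component_majority[of ?U 1 A B] majority by (auto simp: Suc_le_eq)
  let ?C = "component ?U v"
  obtain r i where r: "r \<in> ?C" "attached V P i [r]"
    using attached_exists[OF assms(1,2) v] .
  have C: "?C \<subseteq> V - set P" by (rule component_subset)
  moreover have "card (?C \<inter> A) + of_bool (r \<in> B) \<le> card (?C \<inter> B)"
    using majority_v by (cases "r \<in> B") auto
  ultimately obtain Q where Q: "is_path ?C Q" "hd Q = r" "last Q \<in> B" "nbrs ?C (last Q) \<subseteq> set Q"
    using dfs_leaf[OF conn_component[OF v] _ r(1)] by blast
  have "attached V P i Q"
    using is_path_mono[OF Q(1) C] Q(2) r(2) by (simp add: attached_def)
  moreover have "nbrs V (last Q) \<subseteq> set P \<union> set Q"
    using Q(4) component_nbr[OF is_path_hd_last(5)[OF Q(1)]]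
    unfolding nbrs_def by (simp add: subset_iff) blast
  ultimately show ?thesis using that Q(3) by blast
qed

subsection \<open>Degrees of end vertices of longest paths\<close>

lemma attached_nbr_position_even:
  assumes "is_path V P" "hd P \<in> A" "attached V P i Q" "last Q \<in> B"
    and m: "m \<in> nbr_positions Q (last Q)"
  shows "even (Suc (i + m))"
proof -
  have Q: "is_path (V - set P) Q" "i < length P" using assms(3) by (auto simp: attached_def)
  have "m < length Q" "R (last Q) (Q ! m)" using m by (auto simp: nbr_positions_def)
  then have "Q ! m \<in> A"
    using edge_in_A_iff[of "last Q" "Q ! m"] in_B_iff assms(4) is_path_nth_in[OF Q(1)] V_eq
    by auto
  moreover have "hd (take (Suc i) P @ Q) \<in> A"
    using assms(2) is_path_hd_last(1)[OF assms(1)] by (simp add: hd_append hd_take_Suc)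
  moreover have "(take (Suc i) P @ Q) ! (Suc i + m) = Q ! m"
    using Q(2) by (simp add: nth_append)
  ultimately show ?thesis
    using nth_in_A_iff[OF is_path_attached[OF assms(1,3)], of "Suc i + m"]
      Q(2) \<open>m < length Q\<close> by simp
qed

lemma attached_leaf_degree_sum:
  assumes "longest_path V P" "hd P \<in> A" "attached V P i Q" "last Q \<in> B"
    and "nbrs V (last Q) \<subseteq> set P \<union> set Q"
  shows "card (nbrs V (hd P)) + card (nbrs V (last Q)) \<le> length P div 2"
proof -
  let ?z = "last Q"
  let ?I = "nbr_positions P (hd P)"
    and ?J = "Suc ` nbr_positions P ?z \<union> (\<lambda>m. i + m + 2) ` nbr_positions Q ?z"
  have P: "is_path V P" using assms(1) by (rule longest_path_is_path)
  have "?z \<in> V - set P" using assms(3) is_path_hd_last(5) by (auto simp: attached_def)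
  then have z: "attached V P j [?z]" if "j \<in> nbr_positions P ?z" for j
    using that by (simp add: attached_singleton_iff nbr_positions_def sym)
  have "card ?I + card ?J \<le> length P div 2"
  proof (rule card_add_card_le_half)
    show "?I \<subseteq> {j. j < length P \<and> odd j}" using P assms(2,2) by (rule nbr_positions_odd)
    have "Suc j < length P \<and> odd (Suc j)" if "j \<in> nbr_positions P ?z" for j
      using longest_path_attached_length[OF assms(1) z[OF that]]
        nbr_positions_even[OF P assms(2,4)] that by auto
    moreover have "i + m + 2 < length P \<and> odd (i + m + 2)" if "m \<in> nbr_positions Q ?z" for m
      using attached_nbr_position_even[OF P assms(2-4) that] nbr_positions_last_less[OF that]
        longest_path_attached_length[OF assms(1,3)] by simp
    ultimately show "?J \<subseteq> {j. j < length P \<and> odd j}" by blast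
    have False if "Suc j \<in> ?I" "j \<in> nbr_positions P ?z" for j
      using longest_path_attached_chord[OF assms(1) z[OF that(2)], of "Suc j"] that by simp
    moreover have False if "i + m + 2 \<in> ?I" "m \<in> nbr_positions Q ?z" for m
      using longest_path_attached_chord[OF assms(1,3), of "i + m + 2"] that
        nbr_positions_last_less[OF that(2)] by simp
    ultimately show "?I \<inter> ?J = {}" by auto
  qed
  then show ?thesis
    using card_nbr_positions_eq[OF P longest_path_nbrs_hd[OF assms(1)]]
      card_nbrs_attached_last_le[OF assms(1,3,5)] by linarith
qed

lemma same_ends_outside_vertex:
  assumes "conn V" "longest_path V P" "hd P \<in> A" "last P \<in> A" "card A \<le> card B"
  obtains z where "z \<in> B - set P"
    "card (nbrs V (hd P)) + card (nbrs V z) \<le> length P div 2"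
    "conn (V - {z})" "conn (V - {z} - {hd P})"
proof -
  have P: "is_path V P" using assms(2) by (rule longest_path_is_path)
  have "odd (length P)" using last_in_A_iff[OF P assms(3)] assms(4) by simp
  then have "card (set P \<inter> B) < card (set P \<inter> A)"
    using card_path_Int_A[OF P assms(3)] card_path_Int_B[OF P assms(3)] by (auto elim!: oddE)
  moreover have "card (set P \<inter> A) \<le> card A" "card (set P \<inter> B) \<le> card B"
    by (auto intro: card_mono)
  ultimately have "card (A - set P) < card (B - set P)"
    using assms(5) by (simp add: card_Diff_subset_Int Int_commute)
  then obtain i Q where Q: "attached V P i Q" "last Q \<in> B" "nbrs V (last Q) \<subseteq> set P \<union> set Q"
    using attached_leaf_exists[OF assms(1) P] by blast
  have outside: "last Q \<in> B - set P"
    using Q(1,2) is_path_hd_last(5)[of "V - set P" Q] by (auto simp: attached_def)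
  have "conn (V - {last Q})" using conn_remove_attached_last[OF assms(1) P Q(1,3)] .
  moreover have "longest_path (V - {last Q}) P"
    using assms(2) outside is_path_mono[of "V - {last Q}" _ V]
    by (auto simp: longest_path_def is_path_def)
  ultimately show ?thesis
    using that outside attached_leaf_degree_sum[OF assms(2,3) Q] longest_path_conn_remove_hd
    by blast
qed

lemma same_ends_degree_less:
  assumes "conn V" "longest_path V P" "hd P \<in> A" "last P \<in> A" "u \<in> B - set P"
  shows "card (nbrs V (hd P)) < length P div 2"
proof -
  let ?U = "V - set P" and ?odds = "{j. j < length P \<and> odd j}"
  have P: "is_path V P" using assms(2) by (rule longest_path_is_path)
  have u: "u \<in> ?U" using assms(5) V_eq by auto
  obtain r i where r: "r \<in> component ?U u" "attached V P i [r]"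
    using attached_exists[OF assms(1) P u] .
  have r_in: "r \<in> ?U" and i: "i < length P" "R (P ! i) r"
    using r(2) by (auto simp: attached_singleton_iff)
  have parity: "r \<in> B \<longleftrightarrow> even i"
    using edge_in_A_iff[OF i(2)] in_B_iff[of r] nth_in_A_iff[OF P assms(3) i(1)] r_in
      is_path_nth_in[OF P i(1)] by blast
  obtain Q where Q: "attached V P i Q" "odd i \<Longrightarrow> 2 \<le> length Q" "Q \<noteq> []"
  proof (cases "even i")
    case True
    then show ?thesis using that[of "[r]"] r(2) by simp
  next
    case False
    then have "r \<noteq> u" using parity assms(5) by auto
    moreover have "r \<in> ?U" "u \<in> component ?U u" using r_in u component_self by auto
    ultimately obtain r' where r': "r' \<in> ?U" "R r r'"
      using conn_nbrs_nonempty[OF conn_component[OF u] r(1)] component_subset by fastforce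
    then have "is_path ?U [r, r']"
      using r_in irrefl by (intro is_path_Cons is_path_singleton) auto
    then show ?thesis using that[of "[r, r']"] i by (simp add: attached_def)
  qed
  define j where "j = (if even i then i + 1 else i + 2)"
  have "1 \<le> length Q" using Q(3) by (simp add: Suc_le_eq)
  then have j: "i < j" "odd j" "j \<le> i + length Q" using Q(2) by (auto simp: j_def)
  then have "j \<notin> nbr_positions P (hd P)" "j < length P"
    using longest_path_attached_chord[OF assms(2) Q(1), of j]
      longest_path_attached_length[OF assms(2) Q(1)] by auto
  then have "nbr_positions P (hd P) \<subset> ?odds"
    using nbr_positions_odd[OF P assms(3,3)] j(2) by blast
  then have "card (nbr_positions P (hd P)) < card ?odds" by (intro psubset_card_mono) auto
  then show ?thesis
    using card_nbr_positions_eq[OF P longest_path_nbrs_hd[OF assms(2)]] by (simp add: card_odd_less)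
qed

lemma mixed_ends_degree_sum:
  assumes "conn V" "longest_path V P" "hd P \<in> A" "last P \<in> B" "set P \<noteq> V"
  shows "card (nbrs V (hd P)) + card (nbrs V (last P)) \<le> length P div 2"
proof -
  have P: "is_path V P" using assms(2) by (rule longest_path_is_path)
  have "Suc j < length P \<and> odd (Suc j)" if "j \<in> nbr_positions P (last P)" for j
    using nbr_positions_even[OF P assms(3,4)] nbr_positions_last_less[OF that] that by auto
  then have "card (nbr_positions P (hd P)) + card (Suc ` nbr_positions P (last P)) \<le> length P div 2"
    using nbr_positions_odd[OF P assms(3,3)] longest_path_no_crossing[OF assms(2,1,5)]
    by (intro card_add_card_le_half) auto
  then show ?thesis
    using card_nbr_positions_eq[OF P] longest_path_nbrs_hd[OF assms(2)]
      longest_path_nbrs_last[OF assms(2)] by (simp add: card_image)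
qed

lemma mixed_ends_length_ge:
  assumes "conn V" "longest_path V P" "hd P \<in> A" "last P \<in> B" "set P \<noteq> V"
  shows "4 \<le> length P"
proof -
  have P: "is_path V P" using assms(2) by (rule longest_path_is_path)
  have "even (length P)"
    using last_in_A_iff[OF P assms(3)] assms(4) in_B_iff is_path_hd_last(5)[OF P] by simp
  moreover have "length P \<noteq> 0" using is_path_hd_last(1)[OF P] by simp
  moreover have "length P \<noteq> 2"
  proof
    assume "length P = 2"
    then have "R (last P) (hd P)"
      using is_path_nth_Suc[OF P, of 0] sym is_path_hd_last(1)[OF P]
      by (simp add: hd_conv_nth last_conv_nth)
    then show False using longest_path_no_spanning_cycle[OF assms(2,1,5)] by blast
  qed
  ultimately show ?thesis by presburger
qed

end

section \<open>Edge counts\<close>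

context sym_graph
begin

definition edge_count :: "'a set \<Rightarrow> 'a set \<Rightarrow> nat" where
  "edge_count X Y = (\<Sum>x\<in>X. card (nbrs Y x))"

definition non_edges :: "'a set \<Rightarrow> 'a set \<Rightarrow> ('a \<times> 'a) set" where
  "non_edges X Y = {(x, y) \<in> X \<times> Y. \<not> R x y}"

lemma edge_count_swap:
  assumes "finite X" "finite Y"
  shows "edge_count X Y = edge_count Y X"
proof -
  have card_nbrs: "card (nbrs Z v) = (\<Sum>u\<in>Z. if R v u then 1 else 0)" if "finite Z" for Z v
    using that by (simp add: nbrs_def sum.If_cases Int_def)
  have "(\<Sum>x\<in>X. \<Sum>y\<in>Y. if R x y then 1 else 0) = (\<Sum>y\<in>Y. \<Sum>x\<in>X. if R y x then 1::nat else 0)"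
    by (subst sum.swap) (intro sum.cong if_cong refl commute)
  then show ?thesis
    unfolding edge_count_def card_nbrs[OF assms(1)] card_nbrs[OF assms(2)] .
qed

lemma edge_count_remove_left:
  "finite X \<Longrightarrow> x \<in> X \<Longrightarrow> edge_count X Y = card (nbrs Y x) + edge_count (X - {x}) Y"
  unfolding edge_count_def by (rule sum.remove)

lemma edge_count_remove_right:
  assumes "finite X" "finite Y" "y \<in> Y"
  shows "edge_count X Y = card (nbrs X y) + edge_count X (Y - {y})"
  using edge_count_remove_left[OF assms(2,3), of X] assms edge_count_swap by simp

lemma edge_count_split_left:
  assumes "finite X" "Z \<subseteq> X"
  shows "edge_count X Y = edge_count Z Y + edge_count (X - Z) Y"
  unfolding edge_count_def using sum.subset_diff[OF assms(2,1)] by (simp add: add.commute)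

lemma edge_count_split_right:
  assumes "finite X" "finite Y" "Z \<subseteq> Y"
  shows "edge_count X Y = edge_count X Z + edge_count X (Y - Z)"
  using edge_count_split_left[OF assms(2,3), of X] assms finite_subset[OF assms(3)]
    edge_count_swap[of X Y] edge_count_swap[of X Z] edge_count_swap[of X "Y - Z"] by simp

lemma edge_count_le:
  assumes "\<And>x. x \<in> X \<Longrightarrow> card (nbrs Y x) \<le> d"
  shows "edge_count X Y \<le> card X * d"
  unfolding edge_count_def using sum_bounded_above[OF assms] by simp

lemma card_nbrs_eq_if_edge_count_eq:
  assumes "finite X" "\<And>x. x \<in> X \<Longrightarrow> card (nbrs Y x) \<le> d" "edge_count X Y = card X * d" "x \<in> X"
  shows "card (nbrs Y x) = d"
  using sum_mono_inv[of "\<lambda>x. card (nbrs Y x)" X "\<lambda>_. d" x] assms by (simp add: edge_count_def)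

lemma adjacent_if_card_nbrs_eq:
  "finite Y \<Longrightarrow> card (nbrs Y x) = card Y \<Longrightarrow> y \<in> Y \<Longrightarrow> R x y"
  using card_subset_eq[of Y "nbrs Y x"] by (auto simp: nbrs_def)

lemma finite_non_edges [simp]: "finite X \<Longrightarrow> finite Y \<Longrightarrow> finite (non_edges X Y)"
  unfolding non_edges_def by (rule finite_subset[of _ "X \<times> Y"]) auto

lemma edge_count_add_card_non_edges:
  assumes "finite X" "finite Y"
  shows "edge_count X Y + card (non_edges X Y) = card X * card Y"
proof -
  have "edge_count X Y = card (SIGMA x:X. nbrs Y x)"
    unfolding edge_count_def using assms by simp
  then have "edge_count X Y + card (non_edges X Y) = card ((SIGMA x:X. nbrs Y x) \<union> non_edges X Y)"
    using assms by (subst card_Un_disjoint) (auto, auto simp: non_edges_def)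
  also have "(SIGMA x:X. nbrs Y x) \<union> non_edges X Y = X \<times> Y" by (auto simp: non_edges_def)
  finally show ?thesis by (simp add: card_cartesian_product)
qed

section \<open>Long paths through complete bipartite subgraphs\<close>

definition complete_to :: "'a set \<Rightarrow> 'a set \<Rightarrow> bool" where
  "complete_to T Z \<longleftrightarrow> (\<forall>x\<in>T. \<forall>y\<in>Z. R x y)"

definition has_path :: "'a set \<Rightarrow> nat \<Rightarrow> bool" where
  "has_path X n \<longleftrightarrow> (\<exists>P. is_path X P \<and> length P = n)"

lemma complete_toD: "complete_to T Z \<Longrightarrow> x \<in> T \<Longrightarrow> y \<in> Z \<Longrightarrow> R x y"
  by (simp add: complete_to_def)

lemma complete_to_disjoint: "complete_to T Z \<Longrightarrow> T \<inter> Z = {}"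
  using irrefl by (auto simp: complete_to_def)

lemma has_pathI: "is_path X P \<Longrightarrow> has_path X (length P)"
  by (auto simp: has_path_def)

lemma has_path_mono: "has_path X n \<Longrightarrow> X \<subseteq> Y \<Longrightarrow> has_path Y n"
  unfolding has_path_def using is_path_mono by blast

lemma has_path_shorter:
  assumes "has_path X n" "0 < m" "m \<le> n"
  shows "has_path X m"
proof -
  obtain P where "is_path X P" "length P = n" using assms(1) by (auto simp: has_path_def)
  then have "is_path X (take m P)" "length (take m P) = m"
    using assms(2,3) is_path_take by auto
  then show ?thesis unfolding has_path_def by blast
qed

lemma path_length_less_if_no_path:
  "\<not> has_path X n \<Longrightarrow> is_path X P \<Longrightarrow> 0 < n \<Longrightarrow> length P < n"
  using has_path_shorter[of X "length P" n] has_pathI[of X P] by (meson not_le)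

lemma complete_to_path:
  assumes "finite T" "finite Z" "complete_to T Z" "v \<in> T" "b \<in> Z" "card T \<le> card Z"
  obtains M where "is_path (T \<union> Z) M" "hd M = v" "last M = b" "length M = 2 * card T"
  using assms
proof (induction "card T" arbitrary: T Z v thesis rule: less_induct)
  case less
  note fin = less.prems(2,3) and complete = less.prems(4) and v = less.prems(5)
    and b = less.prems(6)
  show ?case
  proof (cases "T = {v}")
    case True
    have "R v b" using complete v b by (rule complete_toD)
    then show ?thesis
      using less.prems(1)[of "[v, b]"] True b irrefl
      by (auto simp: is_path_def)
  next
    case False
    then obtain w where w: "w \<in> T" "w \<noteq> v" using v by blast
    then have card_T: "card {v, w} \<le> card T" using fin v by (intro card_mono) auto
    have "Z \<noteq> {b}" using card_T w less.prems(7) by auto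
    then obtain b' where b': "b' \<in> Z" "b' \<noteq> b" using b by blast
    obtain M where M: "is_path ((T - {v}) \<union> (Z - {b'})) M" "hd M = w" "last M = b"
      "length M = 2 * card (T - {v})"
    proof (rule less.hyps)
      show "card (T - {v}) < card T" using fin v by (intro psubset_card_mono) auto
      show "card (T - {v}) \<le> card (Z - {b'})" using fin v b' less.prems(7) by simp
      show "complete_to (T - {v}) (Z - {b'})" using complete by (simp add: complete_to_def)
    qed (use fin w b b' in auto)
    have "v \<notin> Z" "b' \<notin> T" using complete_to_disjoint[OF complete] v b' by auto
    then have "v \<notin> set (b' # M)" "b' \<notin> set M" using M(1) v by (auto simp: is_path_def)
    moreover have "is_path (T \<union> Z) M" using M(1) by (rule is_path_mono) auto
    moreover have "R v b'" "R b' w" using complete v w b' sym by (auto dest: complete_toD)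
    ultimately have "is_path (T \<union> Z) (v # b' # M)"
      using v b' M(2) by (intro is_path_Cons) auto
    moreover have "length (v # b' # M) = 2 * card T"
      using M(4) fin v card_T w by simp
    ultimately show ?thesis
      using less.prems(1)[of "v # b' # M"] M(3) is_path_hd_last(1)[OF M(1)] by simp
  qed
qed

lemma complete_to_path_between:
  assumes fin: "finite T" "finite Z" and complete: "complete_to T Z" and X: "T \<subseteq> X" "Z \<subseteq> X"
    and P: "is_path X P" "set P \<inter> T = {}" "R (last P) v" "v \<in> T"
    and Q: "is_path X Q" "set Q \<inter> T = {}" "hd Q \<in> Z"
    and PQ: "set P \<inter> set Q = {}" and card: "card T \<le> card (Z - set P - set Q) + 1"
    and n: "length P + length Q + 2 * card T = Suc n"
  shows "has_path X n"
proof -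
  let ?Z = "insert (hd Q) (Z - set P - set Q)"
  have "card ?Z = card (Z - set P - set Q) + 1"
    using fin is_path_hd_last(2)[OF Q(1)] by simp
  then obtain M where M: "is_path (T \<union> ?Z) M" "hd M = v" "last M = hd Q" "length M = 2 * card T"
    using complete_to_path[of T ?Z v "hd Q"] fin complete P(4) Q(3) card
    by (auto simp: complete_to_def)
  have "T \<union> ?Z \<subseteq> X" using X Q(3) by auto
  then have M_X: "is_path X M" using M(1) is_path_mono by blast
  have M_subset: "set M \<subseteq> T \<union> ?Z" using M(1) by (simp add: is_path_def)
  have "is_path X (P @ M)"
    using P M M_X M_subset PQ is_path_hd_last(2)[OF Q(1)] by (intro is_path_append) auto
  moreover obtain b Q' where Q': "Q = b # Q'" using is_path_hd_last(1)[OF Q(1)] by (cases Q) auto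
  ultimately have "is_path X ((P @ M) @ Q')"
  proof (cases "Q' = []")
    case False
    then have Q'_path: "is_path X Q'" "b \<notin> set Q'" "R b (hd Q')"
      using Q(1) is_path_append_iff[of "[b]" Q' X] by (auto simp: Q')
    moreover have "last (P @ M) = b" using is_path_hd_last(1)[OF M(1)] M(3) Q' by simp
    moreover have "set (P @ M) \<inter> set Q' = {}" using M_subset PQ Q(2) Q'_path(2) by (auto simp: Q')
    ultimately show ?thesis using \<open>is_path X (P @ M)\<close> by (intro is_path_append[of X "P @ M"]) auto
  qed simp
  then show ?thesis unfolding has_path_def using M(4) n Q' by (intro exI[of _ "(P @ M) @ Q'"]) simp
qed

end

context bipartite
begin

lemma complete_to_long_path:
  assumes T: "T \<subseteq> A" and Z: "Z \<subseteq> B" and "complete_to T Z" and card: "card T + 2 \<le> card Z"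
    and P: "is_path V P" "set P \<inter> T = {}" "R (last P) v" "v \<in> T"
    and Q: "is_path V Q" "set Q \<inter> T = {}" "hd Q \<in> Z"
    and PQ: "set P \<inter> set Q = {}" "(set P \<union> set Q) \<inter> Z \<subseteq> {b, b', b''}"
    and n: "length P + length Q + 2 * card T = Suc n"
  shows "has_path V n"
proof -
  have fin: "finite T" "finite Z" using T Z finite_subset_A swap.finite_subset_A by auto
  have "card Z \<le> card ((Z - set P - set Q) \<union> {b, b', b''})"
    using fin PQ(2) by (intro card_mono) auto
  also have "\<dots> \<le> card (Z - set P - set Q) + card {b, b', b''}" by (rule card_Un_le)
  also have "card {b, b', b''} \<le> 3" by (simp add: card_insert_if)
  finally have "card T \<le> card (Z - set P - set Q) + 1" using card by simp
  then show ?thesis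
    using T Z V_eq fin assms by (intro complete_to_path_between[of T Z V P v Q]) auto
qed

lemma complete_to_long_path_if_two_nbrs:
  assumes T: "T \<subseteq> A" and Z: "Z \<subseteq> B" and complete: "complete_to T Z" and card: "card T + 2 \<le> card Z"
    and x: "x \<in> A - T" "R x y" "R x y'" and y: "y \<in> Z" "y' \<in> B" "y \<noteq> y'" "R v y'" "v \<in> T"
    and w: "w \<in> A - T" "w \<noteq> x" "R w z" "z \<in> Z"
  shows "has_path V (2 * card T + 4)"
proof -
  have "card T > 0" using y(5) finite_subset_A[OF T] by (auto simp: card_gt_0_iff)
  then have "\<not> card Z \<le> card {y, y'}" using card y(3) by simp
  then have "\<not> Z \<subseteq> {y, y'}" using card_mono[of "{y, y'}" Z] by auto
  then obtain b where b: "b \<in> Z" "b \<noteq> y" "b \<noteq> y'" by blast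
  have "R v y" using complete y by (auto dest: complete_toD)
  have reversed: "R y x" "R y' x" "R z w" "R y' v" "R y v" using \<open>R v y\<close> x y(4) w(3) sym by blast+
  have sides: "B \<inter> T = {}" "x \<notin> B" "w \<notin> B" using T x w disjoint by auto
  consider (first) "z = y" | (second) "z = y'" | (other) "z \<noteq> y" "z \<noteq> y'" by blast
  then show ?thesis
  proof cases
    case first
    have "is_path V [w, y, x, y']" "is_path V [b]"
      using first x y w b Z sides reversed V_eq by (auto simp: is_path_def)
    then show ?thesis
      using first x y w b Z sides reversed
      by (intro complete_to_long_path[OF T Z complete card, of "[w, y, x, y']" v "[b]" y y' b]) auto
  next
    case second
    have "is_path V [w, y', x, y]" "is_path V [b]"
      using second x y w b Z sides reversed V_eq by (auto simp: is_path_def)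
    then show ?thesis
      using second x y w b Z sides reversed
      by (intro complete_to_long_path[OF T Z complete card, of "[w, y', x, y]" v "[b]" y y' b]) auto
  next
    case other
    have "is_path V [y, x, y']" "is_path V [z, w]"
      using other x y w Z sides reversed V_eq by (auto simp: is_path_def)
    then show ?thesis
      using other x y w Z sides reversed
      by (intro complete_to_long_path[OF T Z complete card, of "[y, x, y']" v "[z, w]" y y' z]) auto
  qed
qed

lemma complete_to_long_path_if_two_outside_nbrs:
  assumes T: "T \<subseteq> A" "complete_to T (B - {z})" "T \<noteq> {}" "card T + 2 \<le> card (B - {z})"
    and u: "u \<in> A - T" "R z u" and u': "u' \<in> A - T" "R z u'" "u \<noteq> u'"
    and z: "z \<in> B" and y: "y \<in> B - {z}" "R u y"
  shows "has_path V (2 * card T + 4)"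
proof -
  let ?Z = "B - {z}"
  obtain v where v: "v \<in> T" using T(3) by blast
  have "card ?Z \<noteq> 1" using T(4) by linarith
  then have "?Z \<noteq> {y}" by (metis is_singletonI is_singleton_altdef)
  then obtain b where b: "b \<in> ?Z" "b \<noteq> y" using y by blast
  have "R y v" using complete_toD[OF T(2) v y(1)] by (rule sym)
  moreover have "R u' z" using u'(2) by (rule sym)
  then have "is_path V [u', z, u, y]" "is_path V [b]"
    using u u' y b z disjoint V_eq by (auto simp: is_path_def)
  ultimately show ?thesis
    using T u u' v y b z disjoint
    by (intro complete_to_long_path[of T ?Z "[u', z, u, y]" v "[b]" y b b]) auto
qed

lemma nbrs_eq_if_complete_to_rest:
  assumes T: "T \<subseteq> A" "complete_to T (B - {z})" and card: "2 \<le> card T" "card T + 2 \<le> card (B - {z})"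
    and z: "z \<in> B" "card (nbrs A z) = card T"
    and rest: "2 \<le> card (A - T)" "\<And>x. x \<in> A - T \<Longrightarrow> nbrs (B - {z}) x \<noteq> {}"
    and no_path: "\<not> has_path V (2 * card T + 4)"
  shows "nbrs A z = T"
proof -
  have "nbrs A z \<subseteq> T"
  proof (rule ccontr)
    assume "\<not> nbrs A z \<subseteq> T"
    then obtain u where "u \<in> nbrs A z" "u \<notin> T" by blast
    then have u: "u \<in> A - T" "R z u" by auto
    then obtain y where y: "y \<in> B - {z}" "R u y" using rest(2)[OF u(1)] by fastforce
    have "has_path V (2 * card T + 4)"
    proof (cases "nbrs A z \<inter> T = {}")
      case True
      have "nbrs A z \<noteq> {u}" using z(2) card(1) by auto
      then obtain u' where "u' \<in> nbrs A z" "u' \<noteq> u" using \<open>u \<in> nbrs A z\<close> by blast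
      moreover from this have "u' \<in> A - T" "R z u'" using True by auto
      moreover have "T \<noteq> {}" using card(1) by auto
      ultimately show ?thesis
        using T card(2) u y z(1)
        by (intro complete_to_long_path_if_two_outside_nbrs[of T z u u' y]) auto
    next
      case False
      then obtain v where v: "v \<in> T" "v \<in> nbrs A z" by blast
      then have "R v z" using commute[of v z] by simp
      have "A - T \<noteq> {u}" using rest(1) by auto
      then obtain w where w: "w \<in> A - T" "w \<noteq> u" using u by blast
      then obtain y' where "y' \<in> B - {z}" "R w y'" using rest(2)[OF w(1)] by fastforce
      moreover have "R u z" using u(2) by (rule sym)
      ultimately show ?thesis
        using T card(2) u y z(1) v(1) \<open>R v z\<close> w
        by (intro complete_to_long_path_if_two_nbrs[of T "B - {z}" u y z v w y']) auto
    qed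
    then show False using no_path by simp
  qed
  then show ?thesis using finite_subset_A[OF T(1)] z(2) by (intro card_subset_eq) auto
qed

end

section \<open>Pendant structures\<close>

context sym_graph
begin

definition pendant_structure :: "nat \<Rightarrow> 'a set \<Rightarrow> 'a set \<Rightarrow> bool" where
  "pendant_structure t X Y \<longleftrightarrow>
     (\<exists>T\<subseteq>X. card T = t \<and> complete_to T Y \<and> (\<forall>x\<in>X - T. card (nbrs Y x) = 1))"

lemma pendant_structureE:
  assumes "pendant_structure t X Y"
  obtains T where "T \<subseteq> X" "card T = t" "complete_to T Y" "\<And>x. x \<in> X - T \<Longrightarrow> card (nbrs Y x) = 1"
  using assms unfolding pendant_structure_def by blast

lemma pendant_structureI:
  assumes "T \<subseteq> X" "card T = t" "complete_to T Y" "\<And>x. x \<in> X - T \<Longrightarrow> card (nbrs Y x) = 1"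
  shows "pendant_structure t X Y"
  using assms unfolding pendant_structure_def by blast

end

context bipartite
begin

lemma pendant_structure_insert_vertex:
  assumes pendant: "pendant_structure t A (B - {z})" and z: "z \<in> B" "card (nbrs A z) = t"
    and card: "2 \<le> t" "t + 2 \<le> card A" "t + 2 \<le> card (B - {z})"
    and no_path: "\<not> has_path V (2 * t + 4)"
  shows "pendant_structure t A B"
proof -
  obtain T where T: "T \<subseteq> A" "card T = t" "complete_to T (B - {z})"
    and pendant_nbr: "\<And>x. x \<in> A - T \<Longrightarrow> card (nbrs (B - {z}) x) = 1"
    using pendant by (rule pendant_structureE) blast
  have "finite T" using T(1) by (rule finite_subset_A)
  then have "card (A - T) = card A - t" using T by (simp add: card_Diff_subset)
  moreover have "nbrs (B - {z}) x \<noteq> {}" if "x \<in> A - T" for x using pendant_nbr[OF that] by auto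
  ultimately have "nbrs A z = T"
    using T z card no_path by (intro nbrs_eq_if_complete_to_rest) auto
  then have adjacent_z: "R x z \<longleftrightarrow> x \<in> T" if "x \<in> A" for x
    using that commute[of x z] by auto
  show ?thesis
  proof (rule pendant_structureI[OF T(1,2)])
    show "complete_to T B"
      using T(1,3) adjacent_z unfolding complete_to_def by blast
    fix x assume x: "x \<in> A - T"
    then have "\<not> R x z" using adjacent_z by blast
    then have "nbrs B x = nbrs (B - {z}) x" by auto
    then show "card (nbrs B x) = 1" using pendant_nbr[OF x] by simp
  qed
qed

lemma pendant_structure_insert_long_path:
  assumes pendant: "pendant_structure t (A - {x}) B" and x: "x \<in> A" "2 \<le> card (nbrs B x)"
    and card: "1 \<le> t" "t + 2 \<le> card (A - {x})" "t + 2 \<le> card B"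
  shows "has_path V (2 * t + 4)"
proof -
  obtain T where T: "T \<subseteq> A - {x}" "card T = t" "complete_to T B"
    and pendant_nbr: "\<And>w. w \<in> A - {x} - T \<Longrightarrow> card (nbrs B w) = 1"
    using pendant by (rule pendant_structureE) blast
  have "A - {x} \<noteq> T" using T(2) card(2) by auto
  then obtain w where w: "w \<in> A - {x} - T" using T(1) by blast
  then have "nbrs B w \<noteq> {}" using pendant_nbr[OF w] by auto
  then obtain y where y: "y \<in> B" "R w y" by auto
  have "\<not> card (nbrs B x) \<le> Suc 0" using x(2) by simp
  then obtain y\<^sub>1 y\<^sub>2 where "y\<^sub>1 \<in> nbrs B x" "y\<^sub>2 \<in> nbrs B x" "y\<^sub>1 \<noteq> y\<^sub>2"
    using card_le_Suc0_iff_eq[OF finite_nbrs[OF finite_B]] by blast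
  moreover obtain v where "v \<in> T" using T(2) card(1) by fastforce
  ultimately show ?thesis
    using complete_to_long_path_if_two_nbrs[of T B x y\<^sub>1 y\<^sub>2 v w y] T card x w y
    by (auto dest: complete_toD)
qed

lemma pendant_structure_insert_pair:
  assumes pendant: "pendant_structure t (A - {x}) (B - {z})"
    and xz: "x \<in> A" "z \<in> B" "\<not> R x z" "nbrs B x \<noteq> {}"
      "card (nbrs B x) + card (nbrs A z) = t + 1"
    and card: "2 \<le> t" "t + 2 \<le> card (A - {x})" "t + 2 \<le> card (B - {z})"
    and no_path: "\<not> has_path V (2 * t + 4)"
  shows "pendant_structure t A B"
proof -
  interpret minus_z: bipartite R "A \<union> (B - {z})" A "B - {z}" by (rule bipartite_subset) auto
  have nbrs_x: "nbrs (B - {z}) x = nbrs B x" using xz(3) by auto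
  have "\<not> has_path (A \<union> (B - {z})) (2 * t + 4)"
    using no_path has_path_mono V_eq by blast
  then have "\<not> 2 \<le> card (nbrs B x)"
    using minus_z.pendant_structure_insert_long_path[OF pendant xz(1)] card nbrs_x by auto
  moreover have "card (nbrs B x) > 0" using xz(4) by (simp add: card_gt_0_iff)
  ultimately have degrees: "card (nbrs B x) = 1" "card (nbrs A z) = t" using xz(5) by auto
  obtain T where T: "T \<subseteq> A - {x}" "card T = t" "complete_to T (B - {z})"
    and pendant_nbr: "\<And>w. w \<in> A - {x} - T \<Longrightarrow> card (nbrs (B - {z}) w) = 1"
    using pendant by (rule pendant_structureE) blast
  have "card (nbrs (B - {z}) w) = 1" if "w \<in> A - T" for w
    using pendant_nbr[of w] that degrees(1) nbrs_x by (cases "w = x") auto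
  then have "pendant_structure t A (B - {z})" using T by (intro pendant_structureI[of T]) auto
  moreover have "t + 2 \<le> card A" using card(2) xz(1) by simp
  ultimately show ?thesis
    using xz(2) degrees(2) card no_path by (intro pendant_structure_insert_vertex) auto
qed

lemma pendant_vertices_common_nbr:
  assumes T: "T \<subseteq> A" "complete_to T B" "T \<noteq> {}" "card T + 2 \<le> card B"
    and pendant: "\<And>x. x \<in> A - T \<Longrightarrow> card (nbrs B x) = 1"
    and no_path: "\<not> has_path V (2 * card T + 3)"
  obtains y where "y \<in> B" "\<And>x. x \<in> A - T \<Longrightarrow> nbrs B x = {y}"
proof (cases "A - T = {}")
  case True
  have "B \<noteq> {}" using T(4) by auto
  then show ?thesis using that True by blast
next
  case False
  then obtain x\<^sub>0 where x\<^sub>0: "x\<^sub>0 \<in> A - T" by blast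
  then obtain y\<^sub>0 where y\<^sub>0: "nbrs B x\<^sub>0 = {y\<^sub>0}"
    using pendant by (metis card_1_singletonE)
  obtain v where "v \<in> T" using T(3) by blast
  have "nbrs B x = {y\<^sub>0}" if x: "x \<in> A - T" for x
  proof (rule ccontr)
    assume "nbrs B x \<noteq> {y\<^sub>0}"
    then obtain y where y: "nbrs B x = {y}" "y \<noteq> y\<^sub>0"
      using pendant[OF x] by (metis card_1_singletonE)
    then have nbrs: "y \<in> B" "R x y" "y\<^sub>0 \<in> B" "R x\<^sub>0 y\<^sub>0" "x \<noteq> x\<^sub>0"
      using y\<^sub>0 by (auto simp: set_eq_iff)
    then have "R y\<^sub>0 x\<^sub>0" "R y v" using complete_toD[OF T(2) \<open>v \<in> T\<close>] sym by blast+
    moreover have "is_path V [x, y]" "is_path V [y\<^sub>0, x\<^sub>0]"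
      using nbrs \<open>R y\<^sub>0 x\<^sub>0\<close> x x\<^sub>0 disjoint V_eq by (auto simp: is_path_def)
    ultimately have "has_path V (2 * card T + 3)"
      using T x x\<^sub>0 nbrs y(2) disjoint \<open>v \<in> T\<close>
      by (intro complete_to_long_path[of T B "[x, y]" v "[y\<^sub>0, x\<^sub>0]" y y\<^sub>0 y\<^sub>0]) auto
    then show False using no_path by simp
  qed
  moreover have "y\<^sub>0 \<in> B" using y\<^sub>0 by (auto simp: set_eq_iff)
  ultimately show ?thesis using that by blast
qed

end

section \<open>Balanced graphs without a spanning path\<close>

context sym_graph
begin

lemma edge_count_le_low_degree:
  assumes "finite X" "finite Y" "F \<subseteq> X" and low: "\<And>u. u \<in> F \<Longrightarrow> card (nbrs Y u) \<le> d"
  shows "edge_count X Y \<le> card F * d + (card X - card F) * card Y"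
    and "edge_count X Y = card F * d + (card X - card F) * card Y \<Longrightarrow> u \<in> F \<Longrightarrow> card (nbrs Y u) = d"
    and "edge_count X Y = card F * d + (card X - card F) * card Y \<Longrightarrow> complete_to (X - F) Y"
proof -
  have fin: "finite F" using assms(3,1) by (rule finite_subset)
  have split: "edge_count X Y = edge_count F Y + edge_count (X - F) Y"
    using assms(1,3) by (rule edge_count_split_left)
  have low_part: "edge_count F Y \<le> card F * d" using low by (rule edge_count_le)
  have card_rest: "card (X - F) = card X - card F" using fin assms(3) by (rule card_Diff_subset)
  have rest: "card (nbrs Y u) \<le> card Y" for u using assms(2) by (rule card_nbrs_le)
  then have rest_part: "edge_count (X - F) Y \<le> (card X - card F) * card Y"
    using edge_count_le[of "X - F" Y "card Y"] card_rest by simp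
  show "edge_count X Y \<le> card F * d + (card X - card F) * card Y"
    using split low_part rest_part by linarith
  assume "edge_count X Y = card F * d + (card X - card F) * card Y"
  then have tight: "edge_count F Y = card F * d" "edge_count (X - F) Y = card (X - F) * card Y"
    unfolding card_rest using split low_part rest_part by linarith+
  show "card (nbrs Y u) = d" if "u \<in> F" for u
    using fin low tight(1) that by (rule card_nbrs_eq_if_edge_count_eq)
  have "card (nbrs Y u) = card Y" if "u \<in> X - F" for u
    using card_nbrs_eq_if_edge_count_eq[OF _ rest tight(2) that] assms(1) by simp
  then show "complete_to (X - F) Y"
    using adjacent_if_card_nbrs_eq[OF assms(2)] by (simp add: complete_to_def)
qed

end

locale balanced_nontraceable = bipartite R V A B
  for R :: "'a \<Rightarrow> 'a \<Rightarrow> bool" and V A B :: "'a set" +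
  fixes s :: nat
  assumes card_A: "card A = s" and card_B: "card B = s"
    and conn_V: "conn V"
    and no_spanning_path: "\<not> has_path V (2 * s)"
begin

lemma balanced_nontraceable_swap: "balanced_nontraceable R V B A s"
  by unfold_locales (use card_A card_B conn_V no_spanning_path in auto)

lemma path_length_less:
  assumes "is_path V P"
  shows "length P < 2 * s"
proof -
  have "A \<noteq> {} \<or> B \<noteq> {}" using is_path_hd_last(4)[OF assms] V_eq by auto
  then have "0 < s" using card_A card_B card_gt_0_iff finite_A finite_B by metis
  then show ?thesis using path_length_less_if_no_path[OF no_spanning_path assms] by simp
qed

lemma card_nbrs_pos:
  assumes "v \<in> V" "w \<in> V" "v \<noteq> w"
  shows "1 \<le> card (nbrs V v)"
  using conn_nbrs_nonempty[OF conn_V assms] by (simp add: Suc_le_eq card_gt_0_iff)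

end

subsection \<open>Longest paths with both ends in the same class\<close>

context bipartite
begin

lemma nbr_positions_eq_odds_minus:
  assumes "is_path V P" "hd P \<in> A" "v \<in> A" "nbrs V v \<subseteq> set P"
    and k: "k < length P" "odd k" "k \<notin> nbr_positions P v"
    and degree: "length P div 2 \<le> card (nbrs V v) + 1"
  shows "nbr_positions P v = {j. j < length P \<and> odd j} - {k}"
proof (rule card_seteq)
  show "nbr_positions P v \<subseteq> {j. j < length P \<and> odd j} - {k}"
    using nbr_positions_odd[OF assms(1-3)] k(3) by blast
  show "card ({j. j < length P \<and> odd j} - {k}) \<le> card (nbr_positions P v)"
    using k degree card_nbr_positions_eq[OF assms(1,4)]
    by (subst card_Diff_singleton) (auto simp: card_odd_less)
qed simp

lemma large_degree_hd_nbr_positions: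
  assumes longest: "longest_path V P" and "hd P \<in> A" and z: "attached V P i [z]" "z \<in> B"
    and degree: "length P div 2 \<le> card (nbrs V (hd P)) + 1"
  shows "even i" and "nbr_positions P (hd P) = {j. j < length P \<and> odd j} - {i + 1}"
proof -
  have P: "is_path V P" using longest by (rule longest_path_is_path)
  have i: "i + 1 < length P" using longest_path_attached_length[OF longest z(1)] by simp
  show "even i"
    using z nth_in_A_iff[OF P assms(2), of i] edge_in_A_iff[of "P ! i" z] in_B_iff[of z]
      is_path_nth_in[OF P, of i] by (auto simp: attached_singleton_iff)
  moreover have "i + 1 \<notin> nbr_positions P (hd P)"
    using longest_path_attached_chord[OF longest z(1), of "i + 1"] by auto
  ultimately show "nbr_positions P (hd P) = {j. j < length P \<and> odd j} - {i + 1}"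
    using P assms(2) longest_path_nbrs_hd[OF longest] i degree
    by (intro nbr_positions_eq_odds_minus) auto
qed

lemma same_ends_not_both_large_degree:
  assumes longest: "longest_path V P" and ends: "hd P \<in> A" "last P \<in> A"
    and length: "7 \<le> length P" and z: "attached V P i [z]" "z \<in> B"
    and degree: "length P div 2 \<le> card (nbrs V (hd P)) + 1"
      "length P div 2 \<le> card (nbrs V (last P)) + 1"
  shows False
proof -
  let ?l = "length P" and ?i = "length P - Suc i"
  let ?odds = "{j. j < ?l \<and> odd j}"
  have odd_l: "odd ?l"
    using last_in_A_iff[OF longest_path_is_path[OF longest] ends(1)] ends(2) by simp
  have i: "i < ?l" using z(1) by (simp add: attached_singleton_iff)
  have z_rev: "attached V (rev P) ?i [z]" using z(1) by (rule attached_singleton_rev)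
  have even_i: "even i" and nbrs_hd: "nbr_positions P (hd P) = ?odds - {i + 1}"
    using large_degree_hd_nbr_positions[OF longest ends(1) z degree(1)] by auto
  have nbrs_last: "nbr_positions (rev P) (last P) = ?odds - {?i + 1}"
    using large_degree_hd_nbr_positions[OF longest_path_rev[OF longest] _ z_rev z(2)] ends degree
    by (simp add: hd_rev)
  show False
  proof (cases "i + 3 < ?l")
    case True
    then have "i + 3 \<in> nbr_positions P (hd P)" "?l - Suc (i + 1) \<in> nbr_positions (rev P) (last P)"
      unfolding nbrs_hd nbrs_last using even_i odd_l by auto
    then show False
      using longest_path_detour[OF longest z(1)] True
        in_nbr_positions_rev_iff[of "i + 1" P "last P"] by simp
  next
    case False
    then have "?i = 2" using i even_i odd_l longest_path_attached_length[OF longest z(1)]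
      by simp presburger
    moreover have "?l - 4 \<in> nbr_positions P (hd P)"
      unfolding nbrs_hd using length odd_l \<open>?i = 2\<close> by auto
    moreover have "5 \<in> nbr_positions (rev P) (last P)"
      unfolding nbrs_last using length \<open>?i = 2\<close> by simp
    ultimately show False
      using longest_path_detour[OF longest_path_rev[OF longest] z_rev]
        in_nbr_positions_rev_iff[of "?l - 4" P "hd P"] length by (simp add: hd_rev last_rev)
  qed
qed

end

lemma same_ends_edge_bound_identity:
  fixes d s :: nat
  assumes "1 \<le> d" "d + 2 \<le> s"
  shows "(d + 1) * d + (s - (d + 1)) * s + 2 * s + (d - 1) * (s - d - 2) = s * s + 2"
proof -
  obtain d' where "d = d' + 1" using assms(1) by (metis le_add_diff_inverse2)
  moreover obtain e where "s = d + 2 + e" using assms(2) by (auto simp: le_iff_add)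
  ultimately show ?thesis by (simp add: algebra_simps)
qed

locale same_ends_nontraceable = balanced_nontraceable +
  fixes P :: "'a list"
  assumes longest: "longest_path V P"
    and ends_in_A: "hd P \<in> A" "last P \<in> A"
    and hd_degree_maximal: "longest_path V P' \<Longrightarrow> hd P' \<in> A \<Longrightarrow> last P' \<in> A \<Longrightarrow>
      card (nbrs V (hd P')) \<le> card (nbrs V (hd P))"
begin

abbreviation (input) hd_degree :: nat where
  "hd_degree \<equiv> card (nbrs V (hd P))"

definition low_degree_ends :: "'a set" where
  "low_degree_ends = insert (last P) (rotation_heads P)"

lemma is_path_P: "is_path V P"
  using longest by (rule longest_path_is_path)

lemma odd_length: "odd (length P)"
  using last_in_A_iff[OF is_path_P] ends_in_A by simp

lemma outside_vertex:
  obtains z where "z \<in> B - set P" "hd_degree + card (nbrs V z) \<le> length P div 2"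
    "1 \<le> card (nbrs V z)"
proof -
  obtain z where z: "z \<in> B - set P" "hd_degree + card (nbrs V z) \<le> length P div 2"
    using same_ends_outside_vertex[OF conn_V longest ends_in_A] card_A card_B by (metis order_refl)
  moreover have "1 \<le> card (nbrs V z)"
    using z(1) is_path_hd_last[OF is_path_P] V_eq by (intro card_nbrs_pos[of z "hd P"]) auto
  ultimately show ?thesis by (rule that)
qed

lemma length_div_2_less: "length P div 2 < s"
  using path_length_less[OF is_path_P] by simp

lemma hd_degree_bounds: "1 \<le> hd_degree" "hd_degree + 2 \<le> s"
proof -
  obtain z where z: "z \<in> B - set P" "hd_degree + card (nbrs V z) \<le> length P div 2"
    "1 \<le> card (nbrs V z)"
    by (rule outside_vertex)
  then show "hd_degree + 2 \<le> s" using length_div_2_less by linarith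
  show "1 \<le> hd_degree"
    using z(1) is_path_hd_last[OF is_path_P] V_eq by (intro card_nbrs_pos[of "hd P" z]) auto
qed

lemma low_degree_ends_subset_A: "low_degree_ends \<subseteq> A"
  using rotation_heads_subset_A[OF is_path_P] ends_in_A by (simp add: low_degree_ends_def)

lemma card_low_degree_ends: "card low_degree_ends = hd_degree + 1"
proof -
  have "last P = P ! (length P - 1)" "length P > 0"
    using is_path_hd_last(1)[OF is_path_P] by (auto simp: last_conv_nth)
  then have "last P \<notin> rotation_heads P"
    using nth_in_rotation_heads_iff[OF is_path_P, of "length P - 1"]
    by (simp add: nbr_positions_def)
  then show ?thesis
    using card_rotation_heads[OF longest] finite_subset[OF rotation_heads_subset[of P]]
    by (simp add: low_degree_ends_def)
qed

lemma low_degree_ends_degree_le: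
  assumes "u \<in> low_degree_ends"
  shows "card (nbrs B u) \<le> hd_degree"
proof -
  have "u \<in> A" using assms low_degree_ends_subset_A by blast
  moreover have "card (nbrs V u) \<le> hd_degree"
  proof (cases "u = last P")
    case True
    then show ?thesis
      using hd_degree_maximal[OF longest_path_rev[OF longest]] ends_in_A
      by (simp add: hd_rev last_rev)
  next
    case False
    then obtain P' where "longest_path V P'" "hd P' = u" "last P' = last P"
      using longest_path_rotation[OF longest] assms by (metis low_degree_ends_def insertE)
    then show ?thesis using hd_degree_maximal[of P'] \<open>u \<in> A\<close> ends_in_A by simp
  qed
  ultimately show ?thesis by (simp add: nbrs_V_eq)
qed

abbreviation (input) degree_bound :: nat where
  "degree_bound \<equiv> (hd_degree + 1) * hd_degree + (s - (hd_degree + 1)) * s"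

lemma edge_count_low_degree_ends:
  shows "edge_count A B \<le> degree_bound"
    and "edge_count A B = degree_bound \<Longrightarrow> u \<in> low_degree_ends \<Longrightarrow> card (nbrs B u) = hd_degree"
    and "edge_count A B = degree_bound \<Longrightarrow> complete_to (A - low_degree_ends) B"
  using edge_count_le_low_degree[OF finite_A finite_B low_degree_ends_subset_A
      low_degree_ends_degree_le]
  unfolding card_low_degree_ends card_A card_B by blast+

lemma edge_bound: "edge_count A B + 2 * s \<le> s * s + 2"
  using edge_count_low_degree_ends(1) same_ends_edge_bound_identity[OF hd_degree_bounds] by linarith

lemma last_degree_neq_hd_degree:
  assumes "4 \<le> s" "hd_degree = s - 2"
  shows "card (nbrs B (last P)) \<noteq> hd_degree"
proof
  assume last_degree: "card (nbrs B (last P)) = hd_degree"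
  obtain z where z: "z \<in> B - set P" "hd_degree + card (nbrs V z) \<le> length P div 2"
    "1 \<le> card (nbrs V z)"
    by (rule outside_vertex)
  then have half: "length P div 2 = s - 1"
    using assms(2) length_div_2_less hd_degree_bounds by linarith
  then have length: "length P = 2 * s - 1" using odd_length hd_degree_bounds(2) by presburger
  then have "card (set P \<inter> A) = card A"
    using card_path_Int_A[OF is_path_P ends_in_A(1)] half card_A by simp
  then have "set P \<inter> A = A" by (intro card_subset_eq) auto
  moreover have "nbrs V z \<noteq> {}" using z(3) by auto
  then obtain w where "w \<in> nbrs V z" by blast
  moreover from this have "w \<in> A" using z(1) swap.nbrs_V_eq[of z] by auto
  ultimately obtain i where "i < length P" "R (P ! i) z"
    using sym by (metis IntE in_nbrs_iff in_set_conv_nth)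
  then have "attached V P i [z]" using z(1) V_eq by (simp add: attached_singleton_iff)
  moreover have "7 \<le> length P" using length assms(1) by linarith
  moreover have "length P div 2 \<le> hd_degree + 1" "length P div 2 \<le> card (nbrs V (last P)) + 1"
    using half assms last_degree nbrs_V_eq[OF ends_in_A(2)] by auto
  ultimately show False
    using same_ends_not_both_large_degree[OF longest ends_in_A] z(1) by blast
qed

lemma pendant_structure_if_extremal:
  assumes "4 \<le> s" "edge_count A B + 2 * s = s * s + 2"
  shows "pendant_structure (s - 2) A B"
proof -
  have "(hd_degree - 1) * (s - hd_degree - 2) = 0"
    and tight: "edge_count A B = degree_bound"
    using edge_count_low_degree_ends(1) same_ends_edge_bound_identity[OF hd_degree_bounds] assms(2)
    by linarith+
  then consider (one) "hd_degree = 1" | (large) "hd_degree = s - 2"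
    using hd_degree_bounds by force
  then show ?thesis
  proof cases
    case one
    have "A - (A - low_degree_ends) = low_degree_ends" using low_degree_ends_subset_A by blast
    moreover have "card (A - low_degree_ends) = s - 2"
      using card_low_degree_ends card_A one finite_subset_A[OF low_degree_ends_subset_A]
        low_degree_ends_subset_A by (simp add: card_Diff_subset)
    ultimately show ?thesis
      using edge_count_low_degree_ends(2,3)[OF tight] one
      by (intro pendant_structureI[of "A - low_degree_ends"]) auto
  next
    case large
    have "last P \<in> low_degree_ends" by (simp add: low_degree_ends_def)
    then show ?thesis
      using last_degree_neq_hd_degree[OF assms(1) large] edge_count_low_degree_ends(2)[OF tight]
      by blast
  qed
qed

end

subsection \<open>Longest paths with ends in different classes\<close>

lemma mixed_ends_edge_bound_identity:
  fixes d f s :: nat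
  assumes "1 \<le> d" "1 \<le> f" "d + f < s"
  shows "d * d + f * f + (s - d) * (s - f) + 2 * s
    + ((d - 1 + (f - 1)) * (s - 1 - (d + f)) + (d - 1) * (f - 1)) = s * s + 3"
proof -
  obtain d' f' where "d = d' + 1" "f = f' + 1"
    using assms(1,2) by (metis le_add_diff_inverse2)
  moreover obtain e where "s = d + f + 1 + e"
    using assms(3) by (metis Suc_eq_plus1 Suc_leI le_iff_add)
  ultimately show ?thesis by (simp add: algebra_simps)
qed

locale mixed_ends_nontraceable = balanced_nontraceable +
  fixes P :: "'a list"
  assumes longest: "longest_path V P"
    and hd_in_A: "hd P \<in> A" and last_in_B: "last P \<in> B"
    and degree_sum_maximal: "longest_path V P' \<Longrightarrow> hd P' \<in> A \<Longrightarrow> last P' \<in> B \<Longrightarrow>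
      card (nbrs V (hd P')) + card (nbrs V (last P')) \<le>
      card (nbrs V (hd P)) + card (nbrs V (last P))"
begin

abbreviation (input) hd_degree :: nat where
  "hd_degree \<equiv> card (nbrs V (hd P))"

abbreviation (input) last_degree :: nat where
  "last_degree \<equiv> card (nbrs V (last P))"

abbreviation (input) half_length :: nat where
  "half_length \<equiv> length P div 2"

definition hd_ends :: "'a set" where
  "hd_ends = rotation_heads P"

definition last_ends :: "'a set" where
  "last_ends = rotation_heads (rev P)"

definition residual :: "('a \<times> 'a) set" where
  "residual = non_edges (A - hd_ends) (B - last_ends)"

lemma is_path_P: "is_path V P"
  using longest by (rule longest_path_is_path)

lemma mixed_ends_nontraceable_swap: "mixed_ends_nontraceable R V B A s (rev P)"
proof (intro mixed_ends_nontraceable.intro balanced_nontraceable_swap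
    mixed_ends_nontraceable_axioms.intro)
  show "longest_path V (rev P)" using longest by (rule longest_path_rev)
  show "hd (rev P) \<in> B" "last (rev P) \<in> A"
    using hd_in_A last_in_B by (simp_all add: hd_rev last_rev)
  show "card (nbrs V (hd P')) + card (nbrs V (last P')) \<le>
      card (nbrs V (hd (rev P))) + card (nbrs V (last (rev P)))"
    if "longest_path V P'" "hd P' \<in> B" "last P' \<in> A" for P'
    using degree_sum_maximal[OF longest_path_rev[OF that(1)]] that(2,3)
    by (simp add: hd_rev last_rev)
qed

lemma length_eq: "length P = 2 * half_length"
  using last_in_A_iff[OF is_path_P hd_in_A] last_in_B in_B_iff is_path_hd_last(5)[OF is_path_P]
  by auto

lemma half_length_less: "half_length < s"
  using path_length_less[OF is_path_P] by simp

lemma card_outside: "card (A - set P) = s - half_length" "card (B - set P) = s - half_length"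
  using card_Diff_subset_Int[of A "set P"] card_Diff_subset_Int[of B "set P"]
    card_path_Int_A[OF is_path_P hd_in_A] card_path_Int_B[OF is_path_P hd_in_A]
    card_A card_B length_eq by (simp_all add: Int_commute) linarith

lemma set_P_neq_V: "set P \<noteq> V"
proof -
  have "card (A - set P) \<noteq> 0" using card_outside(1) half_length_less by simp
  then have "A - set P \<noteq> {}" by (metis card.empty)
  then show ?thesis using V_eq by blast
qed

lemma degree_bounds: "1 \<le> hd_degree" "1 \<le> last_degree" "hd_degree + last_degree \<le> half_length"
proof -
  have "hd P \<noteq> last P" using hd_in_A last_in_B disjoint by auto
  then show "1 \<le> hd_degree" "1 \<le> last_degree"
    using card_nbrs_pos is_path_hd_last[OF is_path_P] by metis+
  show "hd_degree + last_degree \<le> half_length"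
    using mixed_ends_degree_sum[OF conn_V longest hd_in_A last_in_B set_P_neq_V] .
qed

lemma last_not_adjacent_hd: "\<not> R (last P) (hd P)"
  using longest_path_no_spanning_cycle[OF longest conn_V set_P_neq_V] .

lemma length_ge: "4 \<le> length P"
  using mixed_ends_length_ge[OF conn_V longest hd_in_A last_in_B set_P_neq_V] .

lemma hd_ends_subset: "hd_ends \<subseteq> A" "hd_ends \<subseteq> set P"
  using rotation_heads_subset_A[OF is_path_P hd_in_A] rotation_heads_subset
  by (auto simp: hd_ends_def)

lemma last_ends_subset: "last_ends \<subseteq> B" "last_ends \<subseteq> set P"
  using swap.rotation_heads_subset_A[OF is_path_rev[OF is_path_P]] last_in_B
    rotation_heads_subset[of "rev P"] by (auto simp: last_ends_def hd_rev)

lemma card_hd_ends: "card hd_ends = hd_degree"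
  using card_rotation_heads[OF longest] by (simp add: hd_ends_def)

lemma card_last_ends: "card last_ends = last_degree"
  using card_rotation_heads[OF longest_path_rev[OF longest]] by (simp add: last_ends_def hd_rev)

lemma hd_in_hd_ends: "hd P \<in> hd_ends"
  using hd_in_rotation_heads[OF is_path_P] length_ge by (simp add: hd_ends_def)

lemma last_in_last_ends: "last P \<in> last_ends"
  using hd_in_rotation_heads[OF is_path_rev[OF is_path_P]] length_ge
  by (simp add: last_ends_def hd_rev)

lemma hd_ends_degree_le:
  assumes "u \<in> hd_ends"
  shows "card (nbrs B u) \<le> hd_degree"
proof -
  obtain P' where "longest_path V P'" "hd P' = u" "last P' = last P"
    using longest_path_rotation[OF longest] assms by (metis hd_ends_def)
  moreover have "u \<in> A" using assms hd_ends_subset by blast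
  ultimately show ?thesis
    using degree_sum_maximal[of P'] last_in_B nbrs_V_eq[of u] by simp
qed

lemma last_ends_degree_le:
  assumes "v \<in> last_ends"
  shows "card (nbrs A v) \<le> last_degree" "nbrs A v \<subseteq> set P"
proof -
  obtain P' where P': "longest_path V P'" "hd P' = v" "last P' = hd P" "set P' = set P"
    using longest_path_rotation[OF longest_path_rev[OF longest]] assms
    by (metis last_ends_def last_rev set_rev)
  moreover have "v \<in> B" using assms last_ends_subset by blast
  ultimately show "card (nbrs A v) \<le> last_degree" "nbrs A v \<subseteq> set P"
    using degree_sum_maximal[OF longest_path_rev[OF P'(1)]] hd_in_A swap.nbrs_V_eq[of v]
      longest_path_nbrs_hd[OF P'(1)] by (simp_all add: hd_rev last_rev)
qed

lemma finite_residual: "finite residual"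
  by (simp add: residual_def)

lemma edge_count_add_card_residual:
  "edge_count A B + card residual = edge_count hd_ends B + edge_count last_ends (A - hd_ends) +
    (s - hd_degree) * (s - last_degree)"
proof -
  have fin: "finite hd_ends" "finite last_ends"
    using hd_ends_subset last_ends_subset finite_subset_A swap.finite_subset_A by auto
  have "edge_count A B = edge_count hd_ends B + edge_count (A - hd_ends) B"
    using hd_ends_subset by (intro edge_count_split_left) auto
  also have "edge_count (A - hd_ends) B =
      edge_count (A - hd_ends) last_ends + edge_count (A - hd_ends) (B - last_ends)"
    using last_ends_subset by (intro edge_count_split_right) auto
  also have "edge_count (A - hd_ends) last_ends = edge_count last_ends (A - hd_ends)"
    using fin by (intro edge_count_swap) auto
  finally have "edge_count A B = edge_count hd_ends B +
      (edge_count last_ends (A - hd_ends) + edge_count (A - hd_ends) (B - last_ends))" .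
  moreover have "card (A - hd_ends) = s - hd_degree" "card (B - last_ends) = s - last_degree"
    using fin hd_ends_subset last_ends_subset card_A card_B card_hd_ends card_last_ends
    by (simp_all add: card_Diff_subset)
  then have "edge_count (A - hd_ends) (B - last_ends) + card residual =
      (s - hd_degree) * (s - last_degree)"
    using edge_count_add_card_non_edges[of "A - hd_ends" "B - last_ends"]
    by (simp add: residual_def)
  ultimately show ?thesis by simp
qed

lemma edge_count_hd_ends_le: "edge_count hd_ends B \<le> hd_degree * hd_degree"
  using edge_count_le[OF hd_ends_degree_le, of hd_ends] card_hd_ends by simp

lemma last_ends_degree_rest_le:
  assumes "v \<in> last_ends"
  shows "card (nbrs (A - hd_ends) v) \<le> last_degree"
proof -
  have "card (nbrs (A - hd_ends) v) \<le> card (nbrs A v)" by (rule card_mono) auto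
  then show ?thesis using last_ends_degree_le(1)[OF assms] by linarith
qed

lemma edge_count_last_ends_le: "edge_count last_ends (A - hd_ends) \<le> last_degree * last_degree"
  using edge_count_le[OF last_ends_degree_rest_le, of last_ends] card_last_ends by simp

text \<open>
  An edge outside \<open>P\<close> cannot be inserted between two consecutive vertices of \<open>P\<close>, so every free
  position yields a residual non-edge.
\<close>

definition free_positions :: "nat set" where
  "free_positions = {i. odd i \<and> Suc i < length P \<and> P ! i \<notin> last_ends \<and> P ! Suc i \<notin> hd_ends}"

lemma first_position: "1 \<in> nbr_positions P (hd P)"
  using nth_in_rotation_heads_iff[OF is_path_P, of 0] hd_in_hd_ends length_ge
    is_path_hd_last(1)[OF is_path_P] by (simp add: hd_ends_def hd_conv_nth)

lemma last_position: "length P - 1 \<in> Suc ` nbr_positions P (last P)"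
proof -
  have "last P = P ! Suc (length P - 2)"
    using length_ge is_path_hd_last(1)[OF is_path_P]
    by (simp add: last_conv_nth Suc_diff_Suc numeral_2_eq_2)
  then have "length P - 2 \<in> nbr_positions P (last P)"
    using nth_Suc_in_rotation_heads_rev_iff[OF is_path_P, of "length P - 2"] last_in_last_ends
      length_ge
    by (simp add: last_ends_def)
  then show ?thesis using length_ge by (intro image_eqI[of _ _ "length P - 2"]) auto
qed

lemma odd_positions_subset:
  "{j. j < length P \<and> odd j} \<subseteq> free_positions \<union> Suc ` nbr_positions P (last P) \<union>
    (\<lambda>i. i - 2) ` (nbr_positions P (hd P) - {1})" (is "_ \<subseteq> _ \<union> ?J \<union> ?K")
proof (rule subsetI, rule ccontr)
  fix i assume "i \<in> {j. j < length P \<and> odd j}" and not_in: "i \<notin> free_positions \<union> ?J \<union> ?K"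
  then have i: "i < length P" "odd i" by auto
  have "i \<noteq> length P - 1" using not_in last_position by auto
  then have Suc_i: "Suc i < length P" using i by auto
  obtain i' where i': "i = Suc i'" using i by (cases i) auto
  have "P ! i \<notin> last_ends"
    using not_in nth_Suc_in_rotation_heads_rev_iff[OF is_path_P, of i'] i i'
    by (auto simp: last_ends_def)
  moreover have "P ! Suc i \<notin> hd_ends"
  proof
    assume "P ! Suc i \<in> hd_ends"
    then have "i + 2 \<in> nbr_positions P (hd P) - {1}"
      using nth_in_rotation_heads_iff[OF is_path_P Suc_i] by (simp add: hd_ends_def)
    then have "i + 2 - 2 \<in> ?K" by (rule imageI)
    then show False using not_in by simp
  qed
  ultimately show False using not_in i(2) Suc_i by (auto simp: free_positions_def)
qed

lemma card_free_positions: "half_length + 1 \<le> hd_degree + last_degree + card free_positions"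
proof -
  let ?I = "nbr_positions P (hd P)" and ?J = "Suc ` nbr_positions P (last P)"
  let ?K = "(\<lambda>i. i - 2) ` (?I - {1})"
  have "finite free_positions"
    by (rule finite_subset[of _ "{..<length P}"]) (auto simp: free_positions_def)
  then have "card {j. j < length P \<and> odd j} \<le> card (free_positions \<union> ?J \<union> ?K)"
    using odd_positions_subset by (intro card_mono) auto
  also have "\<dots> \<le> card free_positions + card ?J + card ?K"
    by (meson add_right_mono card_Un_le order_trans)
  finally have "half_length \<le> card free_positions + card ?J + card ?K" by (simp add: card_odd_less)
  moreover have "card ?J = last_degree"
    using card_nbr_positions_eq[OF is_path_P longest_path_nbrs_last[OF longest]]
    by (simp add: card_image)
  moreover have "card ?K \<le> card (?I - {1})" by (rule card_image_le) simp
  then have "card ?K + 1 \<le> hd_degree"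
    using card_nbr_positions_eq[OF is_path_P longest_path_nbrs_hd[OF longest]] first_position
      degree_bounds(1) by simp
  ultimately show ?thesis by linarith
qed

lemma free_position_non_edge:
  assumes x: "x \<in> A - set P" and y: "y \<in> B - set P" and "R x y" and i: "i \<in> free_positions"
  shows "(x, P ! i) \<in> residual \<or> (P ! Suc i, y) \<in> residual"
proof -
  have pos: "odd i" "Suc i < length P" "P ! i \<notin> last_ends" "P ! Suc i \<notin> hd_ends"
    using i by (auto simp: free_positions_def)
  have "P ! i \<in> B" "P ! Suc i \<in> A"
    using nth_in_B_iff[OF is_path_P hd_in_A, of i] nth_in_A_iff[OF is_path_P hd_in_A, of "Suc i"]
      pos by auto
  moreover have "\<not> (R x (P ! i) \<and> R (P ! Suc i) y)"
  proof
    assume adjacent: "R x (P ! i) \<and> R (P ! Suc i) y"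
    have "is_path (V - set P) [x, y]"
      using x y \<open>R x y\<close> V_eq disjoint by (auto simp: is_path_def)
    moreover have "R (P ! i) x" "R y (P ! Suc i)" using adjacent sym by blast+
    ultimately show False
      using longest_path_attached_twice[OF longest, of i "[x, y]" "Suc i"] pos
      by (simp add: attached_def)
  qed
  ultimately show ?thesis
    using x y pos hd_ends_subset last_ends_subset by (auto simp: residual_def non_edges_def)
qed

lemma card_residual_ge_if_outside_edge:
  assumes x: "x \<in> A - set P" and y: "y \<in> B - set P" and "R x y"
  shows "half_length + 1 \<le> hd_degree + last_degree + card residual"
proof -
  define g where "g i = (if (x, P ! i) \<in> residual then (x, P ! i) else (P ! Suc i, y))" for i
  have in_set: "P ! i \<in> set P" "P ! Suc i \<in> set P" if "i \<in> free_positions" for i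
    using that by (auto simp: free_positions_def)
  have "inj_on g free_positions"
  proof (rule inj_onI)
    fix i j assume ij: "i \<in> free_positions" "j \<in> free_positions" "g i = g j"
    then have "P ! i = P ! j \<or> P ! Suc i = P ! Suc j"
      using in_set[OF ij(1)] in_set[OF ij(2)] x y by (auto simp: g_def split: if_splits)
    then show "i = j"
      using ij(1,2) is_path_nth_eq_iff[OF is_path_P] by (auto simp: free_positions_def)
  qed
  moreover have "g ` free_positions \<subseteq> residual"
    using free_position_non_edge[OF assms] by (auto simp: g_def)
  ultimately have "card free_positions \<le> card residual"
    using finite_residual by (intro card_inj_on_le)
  then show ?thesis using card_free_positions by linarith
qed

lemma non_edge_at_outside_pair:
  assumes x: "x \<in> A - set P" and y: "y \<in> B - set P"
  shows "\<exists>u v. (u, v) \<in> residual \<and> u \<in> insert x (set P) \<and> v \<in> insert y (set P) \<and>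
    (u = x \<or> v = y)"
proof (cases "R x y")
  case True
  have "card free_positions > 0" using card_free_positions degree_bounds(3) by linarith
  then obtain i where i: "i \<in> free_positions" by fastforce
  then have "P ! i \<in> set P" "P ! Suc i \<in> set P" by (auto simp: free_positions_def)
  then show ?thesis using free_position_non_edge[OF x y True i] by blast
next
  case False
  then have "(x, y) \<in> residual"
    using x y hd_ends_subset last_ends_subset by (auto simp: residual_def non_edges_def)
  then show ?thesis by blast
qed

lemma card_residual_ge: "s - half_length \<le> card residual"
proof -
  obtain \<pi> where \<pi>: "bij_betw \<pi> (A - set P) (B - set P)"
    using finite_same_card_bij[of "A - set P" "B - set P"] card_outside by auto
  have "\<exists>e. e \<in> residual \<and> fst e \<in> insert x (set P) \<and> snd e \<in> insert (\<pi> x) (set P) \<and>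
      (fst e = x \<or> snd e = \<pi> x)" if "x \<in> A - set P" for x
    using non_edge_at_outside_pair[OF that bij_betwE[OF \<pi>, rule_format, OF that]]
    by (metis fst_conv snd_conv)
  then obtain g where g: "g x \<in> residual"
    "fst (g x) \<in> insert x (set P)" "snd (g x) \<in> insert (\<pi> x) (set P)"
    "fst (g x) = x \<or> snd (g x) = \<pi> x" if "x \<in> A - set P" for x
    by metis
  have "inj_on g (A - set P)"
  proof (rule inj_onI)
    fix x x' assume xx': "x \<in> A - set P" "x' \<in> A - set P" "g x = g x'"
    have "\<pi> x \<notin> set P" "\<pi> x' \<notin> set P" using xx'(1,2) bij_betwE[OF \<pi>] by auto
    then have "x = x' \<or> \<pi> x = \<pi> x'" using g[OF xx'(1)] g[OF xx'(2)] xx' by auto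
    then show "x = x'" using \<pi> xx'(1,2) by (auto simp: bij_betw_def inj_on_def)
  qed
  then have "card (A - set P) \<le> card residual"
    using g(1) finite_residual by (intro card_inj_on_le) auto
  then show ?thesis by (simp add: card_outside)
qed

lemma card_residual_pos: "1 \<le> card residual"
  using card_residual_ge half_length_less by linarith

lemma degree_sum_less: "hd_degree + last_degree < s"
  using degree_bounds(3) half_length_less by linarith

lemmas edge_bound_identity = mixed_ends_edge_bound_identity[OF degree_bounds(1,2) degree_sum_less]

lemma edge_bound: "edge_count A B + 2 * s \<le> s * s + 2"
  using edge_bound_identity edge_count_add_card_residual edge_count_hd_ends_le
    edge_count_last_ends_le card_residual_pos
  by linarith

lemma extremal_cases:
  assumes "edge_count A B + 2 * s = s * s + 2"
  shows "card residual = 1" and "s = half_length + 1"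
    and "edge_count last_ends (A - hd_ends) = card last_ends * last_degree"
    and "hd_degree = 1 \<or> last_degree = 1"
    and "hd_degree = 1 \<Longrightarrow> last_degree = 1 \<or> last_degree = s - 2"
proof -
  let ?slack = "s - 1 - (hd_degree + last_degree)"
  have surplus:
      "(hd_degree - 1 + (last_degree - 1)) * ?slack + (hd_degree - 1) * (last_degree - 1) = 0"
    and "card residual = 1" and "edge_count last_ends (A - hd_ends) = last_degree * last_degree"
    using edge_bound_identity edge_count_add_card_residual edge_count_hd_ends_le
      edge_count_last_ends_le card_residual_pos assms by linarith+
  then show "card residual = 1"
    and "edge_count last_ends (A - hd_ends) = card last_ends * last_degree"
    by (simp_all add: card_last_ends)
  then show "s = half_length + 1" using card_residual_ge half_length_less by linarith
  show "hd_degree = 1 \<or> last_degree = 1" using surplus degree_bounds(1,2) by auto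
  assume "hd_degree = 1"
  then have "last_degree - 1 = 0 \<or> ?slack = 0" using surplus by auto
  then show "last_degree = 1 \<or> last_degree = s - 2"
    using \<open>hd_degree = 1\<close> degree_bounds(2) degree_sum_less by linarith
qed

end

locale extremal_mixed_ends = mixed_ends_nontraceable +
  assumes extremal: "edge_count A B + 2 * s = s * s + 2"
    and s_ge: "4 \<le> s"
    and hd_degree_eq: "card (nbrs V (hd P)) = 1"
begin

lemma s_eq: "s = half_length + 1"
  using extremal by (rule extremal_cases)

lemma length_ge_6: "6 \<le> length P"
  using s_eq s_ge length_eq by linarith

lemma hd_ends_eq: "hd_ends = {hd P}"
  using card_hd_ends hd_degree_eq hd_in_hd_ends by (auto simp: card_1_singleton_iff)

lemma nth_in_A: "i < length P \<Longrightarrow> P ! i \<in> A \<longleftrightarrow> even i"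
  using is_path_P hd_in_A by (rule nth_in_A_iff)

lemma nth_in_B: "i < length P \<Longrightarrow> P ! i \<in> B \<longleftrightarrow> odd i"
  using is_path_P hd_in_A by (rule nth_in_B_iff)

lemma nth_eq_hd_iff: "i < length P \<Longrightarrow> P ! i = hd P \<longleftrightarrow> i = 0"
  using is_path_nth_eq_iff[OF is_path_P, of i 0] is_path_hd_last(1)[OF is_path_P]
  by (simp add: hd_conv_nth)

lemma nth_1_notin_last_ends: "P ! 1 \<notin> last_ends"
  using nth_Suc_in_rotation_heads_rev_iff[OF is_path_P, of 0] last_not_adjacent_hd length_ge_6
    is_path_hd_last(1)[OF is_path_P] by (simp add: last_ends_def nbr_positions_def hd_conv_nth)

lemma outside_pair:
  obtains x y where "A - set P = {x}" "B - set P = {y}"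
  using card_outside s_eq by (auto simp: card_1_singleton_iff)

lemma adjacent_if_notin_residual:
  "u \<in> A \<Longrightarrow> u \<noteq> hd P \<Longrightarrow> v \<in> B \<Longrightarrow> v \<notin> last_ends \<Longrightarrow> (u, v) \<notin> residual \<Longrightarrow> R u v"
  by (auto simp: residual_def non_edges_def hd_ends_eq)

lemma residual_eq_singleton: "e \<in> residual \<Longrightarrow> residual = {e}"
  using extremal_cases(1)[OF extremal] by (auto simp: card_1_singleton_iff)

lemma residual_eq_outside_pair:
  assumes "x \<in> A - set P" "y \<in> B - set P" "\<not> R x y"
  shows "residual = {(x, y)}"
  using assms hd_ends_subset last_ends_subset
  by (intro residual_eq_singleton) (auto simp: residual_def non_edges_def)

lemma path_decomposition:
  obtains p\<^sub>0 p\<^sub>1 p\<^sub>2 p\<^sub>3 D where "P = p\<^sub>0 # p\<^sub>1 # p\<^sub>2 # p\<^sub>3 # D" "D \<noteq> []" "hd D = P ! 4"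
proof -
  obtain p\<^sub>0 p\<^sub>1 p\<^sub>2 p\<^sub>3 D where P: "P = p\<^sub>0 # p\<^sub>1 # p\<^sub>2 # p\<^sub>3 # D"
    using length_ge_6 by (auto simp: numeral_eq_Suc Suc_le_length_iff)
  moreover from this have "D \<noteq> []" using length_ge_6 by auto
  ultimately show ?thesis using that by (simp add: hd_conv_nth)
qed

lemma last_degree_neq_one: "last_degree \<noteq> 1"
proof
  assume last_degree: "last_degree = 1"
  obtain x y where "A - set P = {x}" "B - set P = {y}" by (rule outside_pair)
  then have xy: "x \<in> A - set P" "y \<in> B - set P" by blast+
  then have "\<not> R x y"
    using card_residual_ge_if_outside_edge last_degree hd_degree_eq
      extremal_cases(1)[OF extremal] s_eq s_ge
    by fastforce
  then have residual_eq: "residual = {(x, y)}" using xy by (intro residual_eq_outside_pair)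
  have last_ends: "last_ends = {last P}"
    using card_last_ends last_degree last_in_last_ends by (auto simp: card_1_singleton_iff)
  have neq: "P ! i \<noteq> x" "P ! i \<noteq> y" if "i < length P" for i
    using xy that by auto
  have "x \<noteq> hd P" using xy(1) is_path_hd_last(2)[OF is_path_P] by auto
  have "y \<notin> last_ends" "P ! 3 \<notin> last_ends"
    using xy last_ends is_path_hd_last(3)[OF is_path_P] length_ge_6
      is_path_nth_eq_iff[OF is_path_P, of 3 "length P - 1"]
    by (auto simp: last_conv_nth[OF is_path_hd_last(1)[OF is_path_P]])
  then have adjacent: "R x (P ! 1)" "R x (P ! 3)" "R (P ! 2) y" "R (P ! 4) y"
    using xy neq \<open>x \<noteq> hd P\<close> length_ge_6 nth_1_notin_last_ends nth_in_A nth_in_B nth_eq_hd_iff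
    by (intro adjacent_if_notin_residual; auto simp: residual_eq)+
  obtain p\<^sub>0 p\<^sub>1 p\<^sub>2 p\<^sub>3 D where P: "P = p\<^sub>0 # p\<^sub>1 # p\<^sub>2 # p\<^sub>3 # D" "D \<noteq> []" "hd D = P ! 4"
    by (rule path_decomposition)
  have "R p\<^sub>1 x" "R x p\<^sub>3" "R p\<^sub>3 p\<^sub>2" "R p\<^sub>2 y" "R y (hd D)"
    using adjacent is_path_nth_Suc[OF is_path_P, of 2] length_ge_6 P sym
    by (simp_all add: numeral_eq_Suc)
  then have "is_path V (p\<^sub>0 # p\<^sub>1 # x # p\<^sub>3 # p\<^sub>2 # y # D)"
    using is_path_P xy P(2) disjoint V_eq unfolding P(1) is_path_def
    by (auto simp: successively_Cons)
  from longest_path_length_ge[OF longest this] show False by (simp add: P(1))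
qed

lemma last_degree_eq: "last_degree = s - 2"
  using extremal_cases(5)[OF extremal hd_degree_eq] last_degree_neq_one by blast

lemma last_ends_eq: "last_ends = set P \<inter> B - {P ! 1}"
proof (rule card_subset_eq)
  show "last_ends \<subseteq> set P \<inter> B - {P ! 1}" using last_ends_subset nth_1_notin_last_ends by blast
  show "card last_ends = card (set P \<inter> B - {P ! 1})"
    using card_path_Int_B[OF is_path_P hd_in_A] card_last_ends last_degree_eq s_eq length_ge_6
      nth_in_B[of 1]
    by (subst card_Diff_singleton) auto
qed simp

definition inner_A :: "'a set" where
  "inner_A = set P \<inter> A - {hd P}"

lemma card_inner_A: "card inner_A = s - 2"
  using card_path_Int_A[OF is_path_P hd_in_A] length_eq s_eq hd_in_A
    is_path_hd_last(2)[OF is_path_P]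
  unfolding inner_A_def by (subst card_Diff_singleton) auto

lemma complete_to_inner_A_last_ends: "complete_to inner_A last_ends"
proof -
  have "nbrs (A - hd_ends) v = inner_A" if "v \<in> last_ends" for v
  proof (rule card_subset_eq)
    show "nbrs (A - hd_ends) v \<subseteq> inner_A"
      using last_ends_degree_le(2)[OF that] by (auto simp: inner_A_def hd_ends_eq)
    have "finite last_ends" using last_ends_subset by (intro swap.finite_subset_A) auto
    then have "card (nbrs (A - hd_ends) v) = last_degree"
      using last_ends_degree_rest_le extremal_cases(3)[OF extremal] that
      by (rule card_nbrs_eq_if_edge_count_eq)
    then show "card (nbrs (A - hd_ends) v) = card inner_A" using card_inner_A last_degree_eq by simp
  qed (simp add: inner_A_def)
  then have "R v u" if "u \<in> inner_A" "v \<in> last_ends" for u v using that by (metis in_nbrs_iff)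
  then show ?thesis using sym by (simp add: complete_to_def)
qed

lemma outside_pair_not_adjacent:
  assumes x: "x \<in> A - set P" and y: "y \<in> B - set P"
  shows "\<not> R x y"
proof
  assume "R x y"
  have "1 \<in> free_positions"
    using nth_1_notin_last_ends nth_eq_hd_iff[of 2] length_ge_6
    by (simp add: free_positions_def hd_ends_eq numeral_2_eq_2)
  then have "(x, P ! 1) \<in> residual \<or> (P ! 2, y) \<in> residual"
    using free_position_non_edge[OF x y \<open>R x y\<close>] by (simp add: numeral_2_eq_2)
  then have "residual = {(x, P ! 1)} \<or> residual = {(P ! 2, y)}" using residual_eq_singleton by blast
  moreover have "P ! 4 \<noteq> x" "P ! 4 \<noteq> P ! 2" "y \<notin> last_ends"
    using x y length_ge_6 is_path_nth_eq_iff[OF is_path_P, of 4 2] last_ends_subset by auto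
  ultimately have "R (P ! 4) y"
    using y nth_in_A[of 4] nth_eq_hd_iff[of 4] length_ge_6
    by (intro adjacent_if_notin_residual) auto
  moreover have "P ! 2 \<in> inner_A" "last P \<in> last_ends"
    using nth_in_A[of 2] nth_eq_hd_iff[of 2] length_ge_6 last_in_last_ends
    by (auto simp: inner_A_def)
  then have "R (P ! 2) (last P)" using complete_to_inner_A_last_ends by (rule complete_toD[rotated])
  moreover obtain p\<^sub>0 p\<^sub>1 p\<^sub>2 p\<^sub>3 D where P: "P = p\<^sub>0 # p\<^sub>1 # p\<^sub>2 # p\<^sub>3 # D" "D \<noteq> []" "hd D = P ! 4"
    by (rule path_decomposition)
  moreover have "R p\<^sub>0 p\<^sub>1" "R p\<^sub>1 p\<^sub>2"
    using is_path_nth_Suc[OF is_path_P, of 0] is_path_nth_Suc[OF is_path_P, of 1] P(1) by auto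
  ultimately have "R y (hd D)" "R (last D) p\<^sub>2" "R p\<^sub>2 p\<^sub>1" "R p\<^sub>1 p\<^sub>0" using sym by auto
  then have "is_path V ([x, y] @ D @ [p\<^sub>2, p\<^sub>1, p\<^sub>0])"
    using \<open>R x y\<close> is_path_P x y P(2) disjoint V_eq unfolding P(1) is_path_def
    by (auto simp: successively_append_iff successively_Cons)
  from longest_path_length_ge[OF longest this] show False by (simp add: P(1))
qed

lemma pendant_structure_A_B: "pendant_structure (s - 2) A B"
proof (rule pendant_structureI[of inner_A])
  obtain x y where outside_eq: "A - set P = {x}" "B - set P = {y}" by (rule outside_pair)
  then have xy: "x \<in> A - set P" "y \<in> B - set P" by blast+
  then have residual_eq: "residual = {(x, y)}"
    using outside_pair_not_adjacent residual_eq_outside_pair by blast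
  have B: "B = insert (P ! 1) (insert y last_ends)"
    using outside_eq(2) last_ends_eq nth_in_B[of 1] length_ge_6 by auto
  have "y \<notin> last_ends" using xy last_ends_subset by auto
  then have "R u v" if "u \<in> inner_A" "v \<in> B" "v \<notin> last_ends" for u v
    using that xy by (intro adjacent_if_notin_residual) (auto simp: inner_A_def residual_eq)
  then show "complete_to inner_A B"
    using complete_to_inner_A_last_ends unfolding complete_to_def by blast
  show "inner_A \<subseteq> A" "card inner_A = s - 2" using card_inner_A by (auto simp: inner_A_def)
  fix u assume "u \<in> A - inner_A"
  then consider (hd) "u = hd P" | (outside) "u = x" using outside_eq(1) by (auto simp: inner_A_def)
  then show "card (nbrs B u) = 1"
  proof cases
    case hd
    then show ?thesis using hd_degree_eq nbrs_V_eq[OF hd_in_A] by simp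
  next
    case outside
    have "R x (P ! 1)"
      using xy nth_in_B[of 1] nth_1_notin_last_ends is_path_hd_last(2)[OF is_path_P] length_ge_6
      by (intro adjacent_if_notin_residual) (auto simp: residual_eq)
    moreover have "\<not> R x v" if "v \<in> last_ends" for v
      using last_ends_degree_le(2)[OF that] xy commute[of x v] by auto
    ultimately have "nbrs B x = {P ! 1}" using outside_pair_not_adjacent[OF xy] B by auto
    then show ?thesis using outside by simp
  qed
qed

end

context mixed_ends_nontraceable
begin

lemma pendant_structure_if_extremal:
  assumes "4 \<le> s" "edge_count A B + 2 * s = s * s + 2"
  shows "pendant_structure (s - 2) A B \<or> pendant_structure (s - 2) B A"
proof -
  consider (hd) "hd_degree = 1" | (last) "last_degree = 1"
    using extremal_cases(4)[OF assms(2)] by blast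
  then show ?thesis
  proof cases
    case hd
    then interpret extremal_mixed_ends R V A B s P by unfold_locales (use assms in auto)
    show ?thesis using pendant_structure_A_B by blast
  next
    case last
    interpret rev: mixed_ends_nontraceable R V B A s "rev P" by (rule mixed_ends_nontraceable_swap)
    interpret rev: extremal_mixed_ends R V B A s "rev P"
      using assms last edge_count_swap[OF finite_A finite_B] by unfold_locales (auto simp: hd_rev)
    show ?thesis using rev.pendant_structure_A_B by blast
  qed
qed

end

section \<open>Extremal bipartite graphs\<close>

context sym_graph
begin

definition extremal_bound :: "nat \<Rightarrow> 'a set \<Rightarrow> 'a set \<Rightarrow> bool" where
  "extremal_bound t A B \<longleftrightarrow>
     edge_count A B + t \<le> t * card B + card A \<and>
     (2 \<le> t \<longrightarrow> edge_count A B + t = t * card B + card A \<longrightarrow>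
       pendant_structure t A B \<or> card A = card B \<and> pendant_structure t B A)"

end

subsection \<open>The balanced case\<close>

context balanced_nontraceable
begin

lemma extremal_boundI:
  assumes "2 \<le> s" "edge_count A B + 2 * s \<le> s * s + 2"
    and "4 \<le> s \<Longrightarrow> edge_count A B + 2 * s = s * s + 2 \<Longrightarrow>
      pendant_structure (s - 2) A B \<or> pendant_structure (s - 2) B A"
  shows "extremal_bound (s - 2) A B"
proof -
  obtain t where t: "s = t + 2" using assms(1) by (metis le_add_diff_inverse2)
  then have "s * s + 2 + t = t * s + s + 2 * s" by (simp add: algebra_simps)
  then have "edge_count A B + t \<le> t * s + s"
    and "edge_count A B + t = t * s + s \<Longrightarrow> edge_count A B + 2 * s = s * s + 2"
    using assms(2) by linarith+
  then show ?thesis using assms(3) t card_A card_B by (auto simp: extremal_bound_def)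
qed

lemma extremal_bound_if_same_ends:
  assumes "longest_path V P" "hd P \<in> A" "last P \<in> A"
  shows "extremal_bound (s - 2) A B"
proof -
  obtain P' where "longest_path V P'" "hd P' \<in> A \<and> last P' \<in> A"
    "\<And>Q. longest_path V Q \<Longrightarrow> hd Q \<in> A \<and> last Q \<in> A \<Longrightarrow>
      card (nbrs V (hd Q)) \<le> card (nbrs V (hd P'))"
    using longest_path_maximizing[OF finite_V assms(1), of "\<lambda>P. hd P \<in> A \<and> last P \<in> A"
        "\<lambda>P. card (nbrs V (hd P))"] assms(2,3) by blast
  then interpret same_ends_nontraceable R V A B s P' by unfold_locales auto
  show ?thesis
    using hd_degree_bounds edge_bound pendant_structure_if_extremal by (intro extremal_boundI) auto
qed

lemma extremal_bound_if_mixed_ends: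
  assumes "longest_path V P" "hd P \<in> A" "last P \<in> B"
  shows "extremal_bound (s - 2) A B"
proof -
  obtain P' where "longest_path V P'" "hd P' \<in> A \<and> last P' \<in> B"
    "\<And>Q. longest_path V Q \<Longrightarrow> hd Q \<in> A \<and> last Q \<in> B \<Longrightarrow>
      card (nbrs V (hd Q)) + card (nbrs V (last Q)) \<le>
      card (nbrs V (hd P')) + card (nbrs V (last P'))"
    using longest_path_maximizing[OF finite_V assms(1), of "\<lambda>P. hd P \<in> A \<and> last P \<in> B"
        "\<lambda>P. card (nbrs V (hd P)) + card (nbrs V (last P))"] assms(2,3) by blast
  then interpret mixed_ends_nontraceable R V A B s P' by unfold_locales auto
  show ?thesis
    using degree_bounds half_length_less edge_bound pendant_structure_if_extremal
    by (intro extremal_boundI) auto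
qed

lemma extremal_bound_swap_iff: "extremal_bound t B A \<longleftrightarrow> extremal_bound t A B"
  using edge_count_swap[OF finite_A finite_B] card_A card_B by (auto simp: extremal_bound_def)

theorem extremal_bound_balanced:
  assumes "V \<noteq> {}"
  shows "extremal_bound (s - 2) A B"
proof -
  interpret flip: balanced_nontraceable R V B A s by (rule balanced_nontraceable_swap)
  obtain P where P: "longest_path V P" using longest_path_exists[OF finite_V assms] .
  then have "is_path V P" by (rule longest_path_is_path)
  then have "hd P \<in> A \<or> hd P \<in> B" "last P \<in> A \<or> last P \<in> B"
    using is_path_hd_last(4,5)[of V P] V_eq by auto
  then consider (same_A) "hd P \<in> A" "last P \<in> A" | (mixed) "hd P \<in> A" "last P \<in> B"
    | (mixed_rev) "hd P \<in> B" "last P \<in> A" | (same_B) "hd P \<in> B" "last P \<in> B"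
    by blast
  then show ?thesis
  proof cases
    case same_A
    then show ?thesis using P by (intro extremal_bound_if_same_ends)
  next
    case mixed
    then show ?thesis using P by (intro extremal_bound_if_mixed_ends)
  next
    case mixed_rev
    then show ?thesis
      using longest_path_rev[OF P] extremal_bound_if_mixed_ends[of "rev P"]
      by (simp add: hd_rev last_rev)
  next
    case same_B
    then show ?thesis
      using P flip.extremal_bound_if_same_ends extremal_bound_swap_iff by blast
  qed
qed

end

subsection \<open>Removable vertices\<close>

context bipartite
begin

lemma outside_vertex_exists:
  assumes "is_path V P" "hd P \<in> A" "\<not> has_path V (2 * s)" "0 < s" "s \<le> card B"
  obtains u where "u \<in> B - set P" "length P div 2 < s"
proof -
  have half: "length P div 2 < s"
    using path_length_less_if_no_path[OF assms(3,1)] assms(4) by simp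
  then have "card (set P \<inter> B) < card B" using card_path_Int_B[OF assms(1,2)] assms(5) by simp
  then have "\<not> B \<subseteq> set P" by (metis Int_absorb1 less_irrefl)
  then show ?thesis using that half by blast
qed

lemma removable_vertex_if_hd_in_A:
  assumes "conn V" "longest_path V P" "hd P \<in> A"
    and card: "0 < s" "s \<le> card A" "card A \<le> card B" and no_path: "\<not> has_path V (2 * s)"
  shows "\<exists>z\<in>B. card (nbrs A z) + 2 \<le> s \<and> conn (V - {z})"
proof -
  have P: "is_path V P" using assms(2) by (rule longest_path_is_path)
  obtain u where u: "u \<in> B - set P" and half: "length P div 2 < s"
    using outside_vertex_exists[OF P assms(3) no_path] card by auto
  then have "u \<noteq> hd P" "u \<in> V" using is_path_hd_last(2)[OF P] V_eq by auto
  then have "nbrs V (hd P) \<noteq> {}"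
    using conn_nbrs_nonempty[OF assms(1)] is_path_hd_last(4)[OF P] by metis
  then have hd_degree: "1 \<le> card (nbrs V (hd P))" by (simp add: Suc_le_eq card_gt_0_iff)
  show ?thesis
  proof (cases "last P \<in> A")
    case True
    obtain z where z: "z \<in> B" "card (nbrs V (hd P)) + card (nbrs V z) \<le> length P div 2"
      "conn (V - {z})"
      using same_ends_outside_vertex[OF assms(1-3) True card(3)] by blast
    moreover have "card (nbrs A z) + 2 \<le> s"
      using z(2) half hd_degree unfolding swap.nbrs_V_eq[OF z(1)] by linarith
    ultimately show ?thesis by blast
  next
    case False
    then have last: "last P \<in> B" using in_B_iff is_path_hd_last(5)[OF P] by blast
    have "set P \<noteq> V" using u V_eq by auto
    then have "card (nbrs A (last P)) + 2 \<le> s"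
      using mixed_ends_degree_sum[OF assms(1-3) last] half hd_degree
      unfolding swap.nbrs_V_eq[OF last] by linarith
    moreover have "conn (V - {last P})"
      using longest_path_conn_remove_hd[OF assms(1) longest_path_rev[OF assms(2)]]
      by (simp add: hd_rev)
    ultimately show ?thesis using last by blast
  qed
qed

end

context bipartite
begin

lemma removable_vertex:
  assumes "conn V" and card: "0 < s" "s \<le> card A" "card A \<le> card B"
    and no_path: "\<not> has_path V (2 * s)"
  shows "\<exists>z\<in>B. card (nbrs A z) + 2 \<le> s \<and> conn (V - {z})"
proof -
  have "V \<noteq> {}" using card V_eq by auto
  then obtain P where longest: "longest_path V P" using longest_path_exists[OF finite_V] by blast
  then have P: "is_path V P" by (rule longest_path_is_path)
  consider (hd_A) "hd P \<in> A" | (last_A) "last P \<in> A" | (same_B) "hd P \<in> B" "last P \<in> B"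
    using is_path_hd_last(4,5)[OF P] V_eq by blast
  then show ?thesis
  proof cases
    case hd_A
    then show ?thesis using removable_vertex_if_hd_in_A assms longest by blast
  next
    case last_A
    then show ?thesis
      using removable_vertex_if_hd_in_A[OF assms(1) longest_path_rev[OF longest]] assms
      by (simp add: hd_rev)
  next
    case same_B
    obtain u where "u \<in> A - set P" "length P div 2 < s"
      using swap.outside_vertex_exists[OF P same_B(1) no_path card(1,2)] .
    then have "card (nbrs A (hd P)) + 2 \<le> s"
      using swap.same_ends_degree_less[OF assms(1) longest same_B] swap.nbrs_V_eq[OF same_B(1)]
      by fastforce
    then show ?thesis using longest_path_conn_remove_hd[OF assms(1) longest] same_B(1) by blast
  qed
qed

lemma removable_pair_if_hd_in_A:
  assumes "conn V" "longest_path V P" "hd P \<in> A"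
    and card: "0 < s" "s \<le> card A" "card A = card B" and no_path: "\<not> has_path V (2 * s)"
  shows "\<exists>x\<in>A. \<exists>z\<in>B. card (nbrs B x) + card (nbrs A z) < s \<and> conn (V - {z} - {x})"
proof -
  have P: "is_path V P" using assms(2) by (rule longest_path_is_path)
  obtain u where u: "u \<in> B - set P" and half: "length P div 2 < s"
    using outside_vertex_exists[OF P assms(3) no_path] card by auto
  show ?thesis
  proof (cases "last P \<in> A")
    case True
    obtain z where z: "z \<in> B" "card (nbrs V (hd P)) + card (nbrs V z) \<le> length P div 2"
      "conn (V - {z} - {hd P})"
      using same_ends_outside_vertex[OF assms(1-3) True] card(3) by (metis DiffD1 order_refl)
    moreover have "card (nbrs B (hd P)) + card (nbrs A z) < s"
      using z(2) nbrs_V_eq[OF assms(3)] swap.nbrs_V_eq[OF z(1)] half by simp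
    ultimately show ?thesis using assms(3) by blast
  next
    case False
    then have last: "last P \<in> B" using in_B_iff is_path_hd_last(5)[OF P] by blast
    have outside: "set P \<noteq> V" using u V_eq by auto
    have "card (nbrs B (hd P)) + card (nbrs A (last P)) < s"
      using mixed_ends_degree_sum[OF assms(1-3) last outside]
        nbrs_V_eq[OF assms(3)] swap.nbrs_V_eq[OF last] half by simp
    moreover have "conn (V - {last P} - {hd P})"
      using mixed_ends_length_ge[OF assms(1-3) last outside] assms(1) P
        longest_path_nbrs_hd[OF assms(2)] longest_path_nbrs_last[OF assms(2)]
      by (intro conn_remove_both_ends) auto
    ultimately show ?thesis using assms(3) last by blast
  qed
qed

end

context bipartite
begin

lemma removable_pair:
  assumes "conn V" and card: "0 < s" "s \<le> card A" "card A = card B"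
    and no_path: "\<not> has_path V (2 * s)"
  shows "\<exists>x\<in>A. \<exists>z\<in>B. card (nbrs B x) + card (nbrs A z) < s \<and> conn (V - {x, z})"
proof -
  have "V \<noteq> {}" using card V_eq by auto
  then obtain P where longest: "longest_path V P" using longest_path_exists[OF finite_V] by blast
  have remove_two: "V - {z} - {x} = V - {x, z}" "V - {z} - {x} = V - {z, x}" for x z by auto
  consider (hd_A) "hd P \<in> A" | (hd_B) "hd P \<in> B"
    using is_path_hd_last(4)[OF longest_path_is_path[OF longest]] V_eq by blast
  then show ?thesis
  proof cases
    case hd_A
    then show ?thesis
      using removable_pair_if_hd_in_A[OF assms(1) longest _ card no_path] remove_two(1) by simp
  next
    case hd_B
    then show ?thesis
      using swap.removable_pair_if_hd_in_A[OF assms(1) longest hd_B card(1) _ card(3)[symmetric]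
          no_path] card remove_two(2) by (metis add.commute)
  qed
qed

subsection \<open>The inductive steps\<close>

lemma extremal_bound_insert_vertex:
  assumes z: "z \<in> B" "card (nbrs A z) \<le> t"
    and card: "t + 2 \<le> card A" "card A < card B"
    and no_path: "\<not> has_path V (2 * t + 4)"
    and smaller: "extremal_bound t A (B - {z})"
  shows "extremal_bound t A B"
proof -
  have "card B = Suc (card (B - {z}))" using z(1) by (metis card_Suc_Diff1 finite_B)
  then have card_z: "t * card B = t + t * card (B - {z})" "t + 2 \<le> card (B - {z})"
    using card by auto
  have edges: "edge_count A B = card (nbrs A z) + edge_count A (B - {z})"
    using z(1) by (intro edge_count_remove_right) auto
  have smaller_bound: "edge_count A (B - {z}) + t \<le> t * card (B - {z}) + card A"
    using smaller by (simp add: extremal_bound_def)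
  show ?thesis unfolding extremal_bound_def
  proof (intro conjI impI)
    show "edge_count A B + t \<le> t * card B + card A"
      using smaller_bound edges z(2) card_z(1) by linarith
    assume "2 \<le> t" "edge_count A B + t = t * card B + card A"
    then have degree: "card (nbrs A z) = t"
      and "edge_count A (B - {z}) + t = t * card (B - {z}) + card A"
      using smaller_bound edges z(2) card_z(1) by linarith+
    then consider (in_A) "pendant_structure t A (B - {z})"
      | (in_B) "pendant_structure t (B - {z}) A"
      using smaller \<open>2 \<le> t\<close> by (auto simp: extremal_bound_def)
    then show "pendant_structure t A B \<or> card A = card B \<and> pendant_structure t B A"
    proof cases
      case in_A
      then show ?thesis
        using pendant_structure_insert_vertex z(1) degree \<open>2 \<le> t\<close> card(1) card_z(2) no_path by blast
    next
      case in_B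
      then have "has_path V (2 * t + 4)"
        using swap.pendant_structure_insert_long_path[OF in_B z(1)] degree \<open>2 \<le> t\<close> card(1) card_z(2)
        by simp
      then show ?thesis using no_path by blast
    qed
  qed
qed

lemma pendant_structure_insert_pair_cases:
  assumes pendant:
      "pendant_structure t (A - {x}) (B - {z}) \<or> pendant_structure t (B - {z}) (A - {x})"
    and xz: "x \<in> A" "z \<in> B" "\<not> R x z" "nbrs B x \<noteq> {}" "nbrs A z \<noteq> {}"
      "card (nbrs B x) + card (nbrs A z) = t + 1"
    and "2 \<le> t" "t + 2 \<le> card (A - {x})" "t + 2 \<le> card (B - {z})"
    and "\<not> has_path V (2 * t + 4)"
  shows "pendant_structure t A B \<or> pendant_structure t B A"
  using pendant
proof
  assume "pendant_structure t (A - {x}) (B - {z})"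
  then show ?thesis using pendant_structure_insert_pair assms by blast
next
  assume "pendant_structure t (B - {z}) (A - {x})"
  moreover have "\<not> R z x" using xz(3) sym by blast
  moreover have "card (nbrs A z) + card (nbrs B x) = t + 1" using xz(6) by simp
  ultimately show ?thesis using swap.pendant_structure_insert_pair assms by blast
qed

lemma extremal_bound_insert_pair:
  assumes conn_V: "conn V" and xz: "x \<in> A" "z \<in> B" "card (nbrs B x) + card (nbrs A z) \<le> t + 1"
    and card: "t + 3 \<le> card A" "card A = card B"
    and no_path: "\<not> has_path V (2 * t + 4)"
    and smaller: "extremal_bound t (A - {x}) (B - {z})"
  shows "extremal_bound t A B"
proof -
  have card_A: "card A = Suc (card (A - {x}))" using xz(1) by (metis card_Suc_Diff1 finite_A)
  have card_B: "card B = Suc (card (B - {z}))" using xz(2) by (metis card_Suc_Diff1 finite_B)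
  then have t_card_B: "t * card B = t + t * card (B - {z})" by simp
  have edges: "edge_count A B =
      card (nbrs A z) + (card (nbrs (B - {z}) x) + edge_count (A - {x}) (B - {z}))"
    using xz edge_count_remove_right[of A B z] edge_count_remove_left[of A x "B - {z}"] by simp
  have degree_x: "card (nbrs (B - {z}) x) \<le> card (nbrs B x)" by (rule card_mono) auto
  have smaller_bound:
    "edge_count (A - {x}) (B - {z}) + t \<le> t * card (B - {z}) + card (A - {x})"
    using smaller by (simp add: extremal_bound_def)
  show ?thesis unfolding extremal_bound_def
  proof (intro conjI impI)
    show "edge_count A B + t \<le> t * card B + card A"
      using smaller_bound edges xz(3) degree_x t_card_B card_A by linarith
    assume "2 \<le> t" "edge_count A B + t = t * card B + card A"
    then have degree_sum: "card (nbrs B x) + card (nbrs A z) = t + 1"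
      and "card (nbrs (B - {z}) x) = card (nbrs B x)"
      and "edge_count (A - {x}) (B - {z}) + t = t * card (B - {z}) + card (A - {x})"
      using smaller_bound edges xz(3) degree_x t_card_B card_A by linarith+
    then have pendant:
      "pendant_structure t (A - {x}) (B - {z}) \<or> pendant_structure t (B - {z}) (A - {x})"
      using smaller \<open>2 \<le> t\<close> by (auto simp: extremal_bound_def)
    have "nbrs (B - {z}) x = nbrs B x"
      using \<open>card (nbrs (B - {z}) x) = card (nbrs B x)\<close> by (intro card_subset_eq) auto
    then have "\<not> R x z" using xz(2) by (auto simp: set_eq_iff)
    moreover have "nbrs B x \<noteq> {}" "nbrs A z \<noteq> {}"
      using nbrs_B_nonempty[OF conn_V xz(1)] swap.nbrs_B_nonempty[OF conn_V xz(2)] xz by auto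
    ultimately show "pendant_structure t A B \<or> card A = card B \<and> pendant_structure t B A"
      using pendant_structure_insert_pair_cases[OF pendant xz(1,2) _ _ _ degree_sum \<open>2 \<le> t\<close>]
        no_path card card_A card_B by auto
  qed
qed

lemma extremal_bound_step:
  assumes conn_V: "conn V" and card: "t + 2 \<le> card A" "card A \<le> card B"
    and no_path: "\<not> has_path V (2 * t + 4)"
    and smaller: "\<And>A' B'. A' \<subseteq> A \<Longrightarrow> B' \<subseteq> B \<Longrightarrow> A' \<union> B' \<subset> V \<Longrightarrow> conn (A' \<union> B') \<Longrightarrow>
      t + 2 \<le> card A' \<Longrightarrow> card A' \<le> card B' \<Longrightarrow> extremal_bound t A' B'"
  shows "extremal_bound t A B"
proof -
  have "2 * (t + 2) = 2 * t + 4" by simp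
  then have no_path': "\<not> has_path V (2 * (t + 2))" using no_path by metis
  consider (unbalanced) "card A < card B" | (tight) "card A = card B" "card A = t + 2"
    | (balanced) "card A = card B" "t + 3 \<le> card A"
    using card by linarith
  then show ?thesis
  proof cases
    case unbalanced
    obtain z where z: "z \<in> B" "card (nbrs A z) \<le> t" "conn (V - {z})"
      using removable_vertex[OF conn_V _ card no_path'] by auto
    moreover have "V - {z} = A \<union> (B - {z})" using z(1) V_eq disjoint by auto
    ultimately have "extremal_bound t A (B - {z})"
      using V_eq unbalanced card by (intro smaller) auto
    then show ?thesis
      using z(1,2) card(1) unbalanced no_path by (intro extremal_bound_insert_vertex)
  next
    case tight
    then interpret balanced_nontraceable R V A B "t + 2"
      using conn_V no_path' by unfold_locales auto
    have "V \<noteq> {}" using card V_eq by auto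
    then show ?thesis using extremal_bound_balanced by simp
  next
    case balanced
    obtain x z where xz: "x \<in> A" "z \<in> B" "card (nbrs B x) + card (nbrs A z) < t + 2"
      and "conn (V - {x, z})"
      using removable_pair[OF conn_V _ card(1) balanced(1) no_path'] by auto
    moreover have "V - {x, z} = (A - {x}) \<union> (B - {z})" using xz(1,2) V_eq disjoint by auto
    ultimately have "extremal_bound t (A - {x}) (B - {z})"
      using V_eq balanced by (intro smaller) auto
    then show ?thesis
      using conn_V xz balanced no_path by (intro extremal_bound_insert_pair) auto
  qed
qed

end

theorem (in sym_graph) extremal_bound_if_no_path:
  assumes "bipartite R V A B" "conn V" "t + 2 \<le> card A" "card A \<le> card B"
    and "\<not> has_path V (2 * t + 4)"
  shows "extremal_bound t A B"
  using assms
proof (induction "card V" arbitrary: V A B rule: less_induct)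
  case less
  interpret bipartite R V A B by fact
  show ?case
  proof (rule extremal_bound_step[OF less.prems(2-5)])
    fix A' B'
    assume subsets: "A' \<subseteq> A" "B' \<subseteq> B" "A' \<union> B' \<subset> V"
      and "conn (A' \<union> B')" "t + 2 \<le> card A'" "card A' \<le> card B'"
    show "extremal_bound t A' B'"
    proof (rule less.hyps)
      show "card (A' \<union> B') < card V" using subsets(3) by (intro psubset_card_mono) auto
      show "bipartite R (A' \<union> B') A' B'" using subsets(1,2) by (rule bipartite_subset)
      show "\<not> has_path (A' \<union> B') (2 * t + 4)"
        using less.prems(5) has_path_mono subsets(3) by blast
    qed fact+
  qed
qed

section \<open>Graphs with a pendant structure\<close>

lemma t_par_eq: "3 \<le> k \<Longrightarrow> t_par k = (k - 3) div 2"
  unfolding t_par_def using floor_divide_of_nat_eq[of "k - 3" 2, where 'a = real] by simp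

lemma t_par_bounds:
  assumes "8 \<le> k" "k \<le> 2 * a"
  shows "2 \<le> t_par k" "t_par k + 2 \<le> a" "k \<le> 2 * t_par k + 4" "odd k \<Longrightarrow> k = 2 * t_par k + 3"
proof -
  have t: "t_par k = (k - 3) div 2" using assms(1) by (simp add: t_par_eq)
  show "2 \<le> t_par k" using assms unfolding t by linarith
  show "t_par k + 2 \<le> a" using assms unfolding t by linarith
  show "k \<le> 2 * t_par k + 4" unfolding t by linarith
  show "k = 2 * t_par k + 3" if "odd k" using assms(1) that unfolding t by presburger
qed

lemma pendant_extension_edge_iff:
  "{Inl i, Inr j} \<in> edges (pendant_extension t a b f) \<longleftrightarrow>
     (i < t \<and> j < b) \<or> (t \<le> i \<and> i < a \<and> j = f i)"
  "{Inr j, Inl i} \<in> edges (pendant_extension t a b f) \<longleftrightarrow>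
     (i < t \<and> j < b) \<or> (t \<le> i \<and> i < a \<and> j = f i)"
  "{Inl i, Inl i'} \<notin> edges (pendant_extension t a b f)"
  "{Inr j, Inr j'} \<notin> edges (pendant_extension t a b f)"
  by (auto simp: pendant_extension_def complete_bipartite_def doubleton_eq_iff)

lemma verts_pendant_extension:
  "t \<le> a \<Longrightarrow> verts (pendant_extension t a b f) = Inl ` {..<a} \<union> Inr ` {..<b}"
  by (auto simp: pendant_extension_def complete_bipartite_def image_iff)

lemma simple_graph_pendant_extension:
  assumes "\<And>i. i \<in> {t..<a} \<Longrightarrow> f i < b" "t \<le> a"
  shows "simple_graph (pendant_extension t a b f)"
  unfolding simple_graph_def verts_pendant_extension[OF assms(2)]
  using assms by (auto simp: pendant_extension_def complete_bipartite_def)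

lemma card_edges_pendant_extension:
  "card (edges (pendant_extension t a b f)) = t * b + (a - t)"
proof -
  let ?edge = "\<lambda>(i, j). {Inl i, Inr j} :: (nat + nat) set"
  let ?S = "{..<t} \<times> {..<b}" and ?pendant = "(\<lambda>i. (i, f i)) ` {t..<a}"
  have edges: "edges (pendant_extension t a b f) = ?edge ` (?S \<union> ?pendant)"
    by (auto simp: pendant_extension_def complete_bipartite_def)
  have "inj_on ?edge (?S \<union> ?pendant)" by (auto simp: inj_on_def doubleton_eq_iff)
  then have "card (edges (pendant_extension t a b f)) = card (?S \<union> ?pendant)"
    unfolding edges by (rule card_image)
  also have "\<dots> = card ?S + card ?pendant" by (rule card_Un_disjoint) auto
  also have "card ?pendant = a - t" by (subst card_image) (auto simp: inj_on_def)
  finally show ?thesis by (simp add: card_cartesian_product)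
qed

lemma graph_iso_edges_image:
  assumes "simple_graph G" "simple_graph H" and f: "f ` verts G = verts H"
    and edge_iff: "\<And>u v. u \<in> verts G \<Longrightarrow> v \<in> verts G \<Longrightarrow> {u, v} \<in> edges G \<longleftrightarrow> {f u, f v} \<in> edges H"
  shows "(`) f ` edges G = edges H"
proof
  show "(`) f ` edges G \<subseteq> edges H"
  proof
    fix e assume "e \<in> (`) f ` edges G"
    then obtain e' where e': "e' \<in> edges G" "e = f ` e'" by blast
    then obtain u v where "e' = {u, v}" "{u, v} \<subseteq> verts G"
      using assms(1) by (metis card_2_iff simple_graph_def)
    then show "e \<in> edges H" using e' edge_iff[of u v] by auto
  qed
  show "edges H \<subseteq> (`) f ` edges G"
  proof
    fix e assume e: "e \<in> edges H"
    then obtain u' v' where e_eq: "e = {u', v'}" and "u' \<in> verts H" "v' \<in> verts H"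
      using assms(2) by (auto simp: simple_graph_def card_2_iff)
    then obtain u v where uv: "u \<in> verts G" "v \<in> verts G" "u' = f u" "v' = f v"
      using f by (metis imageE)
    then have "{u, v} \<in> edges G" using e e_eq edge_iff by simp
    moreover have "e = f ` {u, v}" using e_eq uv(3,4) by simp
    ultimately show "e \<in> (`) f ` edges G" by (rule rev_image_eqI)
  qed
qed

lemma graph_iso_card_edges:
  assumes "simple_graph G" "simple_graph H" "G \<simeq>\<^sub>g H"
  shows "card (edges G) = card (edges H)"
proof -
  obtain f where f: "bij_betw f (verts G) (verts H)"
    and "\<And>u v. u \<in> verts G \<Longrightarrow> v \<in> verts G \<Longrightarrow> {u, v} \<in> edges G \<longleftrightarrow> {f u, f v} \<in> edges H"
    using assms(3) unfolding graph_iso_def by blast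
  then have "(`) f ` edges G = edges H"
    using assms(1,2) by (intro graph_iso_edges_image) (auto simp: bij_betw_def)
  moreover have "inj_on ((`) f) (edges G)"
    using inj_on_image_Pow[OF bij_betw_imp_inj_on[OF f]]
    by (rule inj_on_subset) (use assms(1) in \<open>auto simp: simple_graph_def\<close>)
  ultimately show ?thesis by (metis card_image)
qed

lemma ex_bij_betw_initial_segment:
  assumes "finite A" "T \<subseteq> A"
  obtains h where "bij_betw h A {..<card A}" "h ` T = {..<card T}"
proof -
  have fin: "finite T" using assms(2,1) by (rule finite_subset)
  obtain h\<^sub>1 where h\<^sub>1: "bij_betw h\<^sub>1 T {..<card T}"
    using finite_same_card_bij[of T "{..<card T}"] fin by auto
  have "card (A - T) = card {card T..<card A}" using fin assms by (simp add: card_Diff_subset)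
  then obtain h\<^sub>2 where h\<^sub>2: "bij_betw h\<^sub>2 (A - T) {card T..<card A}"
    using finite_same_card_bij[of "A - T" "{card T..<card A}"] assms(1) by auto
  define h where "h v = (if v \<in> T then h\<^sub>1 v else h\<^sub>2 v)" for v
  have h_T: "bij_betw h T {..<card T}"
    using h\<^sub>1 by (rule bij_betw_cong[THEN iffD1, rotated]) (simp add: h_def)
  moreover have "bij_betw h (A - T) {card T..<card A}"
    using h\<^sub>2 by (rule bij_betw_cong[THEN iffD1, rotated]) (simp add: h_def)
  ultimately have "bij_betw h (T \<union> (A - T)) ({..<card T} \<union> {card T..<card A})"
    by (rule bij_betw_combine) auto
  moreover have "T \<union> (A - T) = A" "{..<card T} \<union> {card T..<card A} = {..<card A}"
    using assms card_mono[OF assms] by auto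
  ultimately show ?thesis using that[of h] h_T by (simp add: bij_betw_def)
qed

subsection \<open>Graphs as adjacency relations\<close>

definition adjacent :: "'a ugraph \<Rightarrow> 'a \<Rightarrow> 'a \<Rightarrow> bool" where
  "adjacent G x y \<longleftrightarrow> {x, y} \<in> edges G"

lemma sym_graph_adjacent:
  assumes "simple_graph G"
  shows "sym_graph (adjacent G)"
proof
  show "adjacent G y x" if "adjacent G x y" for x y
    using that by (simp add: adjacent_def insert_commute)
  have "card {x, x} \<noteq> 2" for x :: 'a by simp
  then show "\<not> adjacent G x x" for x using assms unfolding simple_graph_def adjacent_def by metis
qed

lemma graph_iso_path_graph:
  assumes "distinct xs"
  shows "\<lparr>verts = set xs, edges = {{xs ! i, xs ! Suc i} | i. Suc i < length xs}\<rparr>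
    \<simeq>\<^sub>g path_graph (length xs)"
proof -
  let ?H = "\<lparr>verts = set xs, edges = {{xs ! i, xs ! Suc i} | i. Suc i < length xs}\<rparr>"
  define g where "g = the_inv_into {..<length xs} ((!) xs)"
  have bij: "bij_betw ((!) xs) {..<length xs} (set xs)"
    using assms by (rule bij_betw_nth) auto
  then have g_nth: "g (xs ! i) = i" if "i < length xs" for i
    unfolding g_def using that by (intro the_inv_into_f_f) (auto simp: bij_betw_def)
  show ?thesis
    unfolding graph_iso_def
  proof (intro exI[of _ g] conjI ballI)
    show "bij_betw g (verts ?H) (verts (path_graph (length xs)))"
      using bij_betw_the_inv_into[OF bij] by (simp add: g_def path_graph_def)
    fix u v assume "u \<in> verts ?H" "v \<in> verts ?H"
    then obtain i j where ij: "i < length xs" "j < length xs" "u = xs ! i" "v = xs ! j"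
      by (auto simp: in_set_conv_nth)
    have "{u, v} \<in> edges ?H \<longleftrightarrow> j = Suc i \<or> i = Suc j"
      using ij assms by (auto simp: doubleton_eq_iff nth_eq_iff_index_eq)
    moreover have "{g u, g v} \<in> edges (path_graph (length xs)) \<longleftrightarrow> j = Suc i \<or> i = Suc j"
      using ij g_nth by (auto simp: path_graph_def doubleton_eq_iff)
    ultimately show "{u, v} \<in> edges ?H \<longleftrightarrow> {g u, g v} \<in> edges (path_graph (length xs))" by simp
  qed
qed

lemma path_free_imp_no_path:
  assumes "simple_graph G" "path_free k G"
  shows "\<not> sym_graph.has_path (adjacent G) (verts G) k"
proof
  interpret sym_graph "adjacent G" using assms(1) by (rule sym_graph_adjacent)
  assume "has_path (verts G) k"
  then obtain P where P: "is_path (verts G) P" "length P = k" by (auto simp: has_path_def)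
  let ?H = "\<lparr>verts = set P, edges = {{P ! i, P ! Suc i} | i. Suc i < length P}\<rparr>"
  have "{P ! i, P ! Suc i} \<in> edges G" if "Suc i < length P" for i
    using is_path_nth_Suc[OF P(1) that] by (simp add: adjacent_def)
  moreover have "card {P ! i, P ! Suc i} = 2" if "Suc i < length P" for i
    using is_path_nth_eq_iff[OF P(1)] that by simp
  ultimately have "subgraph ?H G"
    using P(1) by (auto simp: subgraph_def simple_graph_def is_path_def)
  then show False
    using assms(2) graph_iso_path_graph[of P] P unfolding path_free_def is_path_def by blast
qed

lemma conn_verts_if_connected_graph:
  assumes "simple_graph G" "connected_graph G"
  shows "sym_graph.conn (adjacent G) (verts G)"
proof -
  interpret sym_graph "adjacent G" using assms(1) by (rule sym_graph_adjacent)
  have "adjacent G x y \<Longrightarrow> x \<in> verts G \<and> y \<in> verts G" for x y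
    using assms(1) unfolding simple_graph_def adjacent_def by blast
  then have "(\<lambda>x y. adjacent G x y \<and> x \<in> verts G \<and> y \<in> verts G) = (\<lambda>x y. {x, y} \<in> edges G)"
    by (auto simp: fun_eq_iff adjacent_def)
  then show ?thesis
    using assms(2) by (simp add: conn_def reach_def connected_graph_def)
qed

locale bipartite_ugraph =
  fixes G :: "'a ugraph" and A B :: "'a set"
  assumes simple: "simple_graph G" and bipartition: "bipartition G A B"
begin

lemma edge_between: "e \<in> edges G \<Longrightarrow> \<exists>x\<in>A. \<exists>y\<in>B. e = {x, y}"
  using bipartition by (simp add: bipartition_def)

sublocale bipartite "adjacent G" "verts G" A B
proof (intro bipartite.intro sym_graph_adjacent[OF simple] bipartite_axioms.intro)
  show V: "verts G = A \<union> B" and disjoint: "A \<inter> B = {}"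
    using bipartition by (auto simp: bipartition_def)
  have "finite (verts G)" using simple by (simp add: simple_graph_def)
  then show "finite A" "finite B" using V by auto
  show "\<not> adjacent G x y" if "x \<in> A" "y \<in> A" for x y
    using edge_between[of "{x, y}"] disjoint that by (auto simp: adjacent_def doubleton_eq_iff)
  show "\<not> adjacent G x y" if "x \<in> B" "y \<in> B" for x y
    using edge_between[of "{x, y}"] disjoint that by (auto simp: adjacent_def doubleton_eq_iff)
qed

lemma bipartite_ugraph_swap: "bipartite_ugraph G B A"
proof
  show "bipartition G B A"
    using bipartition unfolding bipartition_def by (metis Int_commute Un_commute insert_commute)
qed (rule simple)

lemma card_edges_eq_edge_count: "card (edges G) = edge_count A B"
proof -
  let ?edge = "\<lambda>(x, y). {x, y}"
  have "edges G = ?edge ` (SIGMA x:A. nbrs B x)"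
    using edge_between by (fastforce simp: adjacent_def image_iff)
  moreover have "inj_on ?edge (SIGMA x:A. nbrs B x)"
    using disjoint by (auto simp: inj_on_def doubleton_eq_iff)
  ultimately show ?thesis by (simp add: card_image edge_count_def)
qed

subsection \<open>Isomorphism with a pendant extension\<close>

lemma graph_iso_pendant_extensionI:
  assumes h: "bij_betw h A {..<a}" and g: "bij_betw g B {..<b}" and "t \<le> a"
    and edge_iff: "\<And>x y. x \<in> A \<Longrightarrow> y \<in> B \<Longrightarrow>
      {x, y} \<in> edges G \<longleftrightarrow> {Inl (h x), Inr (g y)} \<in> edges (pendant_extension t a b f)"
  shows "G \<simeq>\<^sub>g pendant_extension t a b f"
  unfolding graph_iso_def
proof (intro exI conjI ballI)
  let ?F = "\<lambda>v. if v \<in> A then Inl (h v) else Inr (g v)"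
  have F: "v \<in> A \<Longrightarrow> ?F v = Inl (h v)" "v \<in> B \<Longrightarrow> ?F v = Inr (g v)" for v
    using disjoint by auto
  have "bij_betw ?F A (Inl ` {..<a})" "bij_betw ?F B (Inr ` {..<b})"
    using h g F by (auto simp: bij_betw_def inj_on_def image_def)
  then have "bij_betw ?F (A \<union> B) (Inl ` {..<a} \<union> Inr ` {..<b})"
    by (rule bij_betw_combine) auto
  then show "bij_betw ?F (verts G) (verts (pendant_extension t a b f))"
    using verts_pendant_extension[OF assms(3)] V_eq by simp
  fix u v assume "u \<in> verts G" "v \<in> verts G"
  then consider (AB) "u \<in> A" "v \<in> B" | (BA) "u \<in> B" "v \<in> A" | (AA) "u \<in> A" "v \<in> A"
    | (BB) "u \<in> B" "v \<in> B"
    using V_eq by blast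
  then show "{u, v} \<in> edges G \<longleftrightarrow> {?F u, ?F v} \<in> edges (pendant_extension t a b f)"
  proof cases
    case AB
    then show ?thesis using edge_iff F by simp
  next
    case BA
    then show ?thesis using edge_iff[of v u] F by (simp add: insert_commute)
  next
    case AA
    then show ?thesis
      using indep_A[OF AA] by (simp add: pendant_extension_edge_iff adjacent_def)
  next
    case BB
    then show ?thesis
      using indep_B[OF BB] F by (simp add: pendant_extension_edge_iff adjacent_def)
  qed
qed

lemma graph_iso_pendant_extension:
  assumes T: "T \<subseteq> A" "complete_to T B" and n: "\<And>x. x \<in> A - T \<Longrightarrow> nbrs B x = {n x}"
    and h: "bij_betw h A {..<card A}" "h ` T = {..<card T}" and g: "bij_betw g B {..<card B}"
  shows "G \<simeq>\<^sub>g pendant_extension (card T) (card A) (card B) (\<lambda>i. g (n (inv_into A h i)))"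
proof (rule graph_iso_pendant_extensionI[OF h(1) g card_mono[OF finite_A T(1)]])
  fix x y assume x: "x \<in> A" and y: "y \<in> B"
  have inj: "inj_on h A" "inj_on g B" using h(1) g by (auto simp: bij_betw_def)
  have range: "h x < card A" "g y < card B" using h(1) g x y by (auto simp: bij_betw_def)
  have in_T_iff: "h x < card T \<longleftrightarrow> x \<in> T"
    using h(2) inj(1) T(1) x by (metis imageI inj_on_image_mem_iff lessThan_iff)
  show "{x, y} \<in> edges G \<longleftrightarrow> {Inl (h x), Inr (g y)} \<in>
      edges (pendant_extension (card T) (card A) (card B) (\<lambda>i. g (n (inv_into A h i))))"
  proof (cases "x \<in> T")
    case True
    then show ?thesis
      using complete_toD[OF T(2) True y] in_T_iff range
      by (simp add: pendant_extension_edge_iff adjacent_def)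
  next
    case False
    then have nbrs_x: "nbrs B x = {n x}" using n x by blast
    then have "n x \<in> nbrs B x" by simp
    then have "g y = g (n x) \<longleftrightarrow> y = n x" using inj_on_eq_iff[OF inj(2) y] by simp
    also have "\<dots> \<longleftrightarrow> y \<in> nbrs B x" using nbrs_x by simp
    also have "\<dots> \<longleftrightarrow> {x, y} \<in> edges G" using y by (simp add: adjacent_def)
    finally show ?thesis
      using False in_T_iff range x inj(1) by (simp add: pendant_extension_edge_iff)
  qed
qed

lemma inv_into_initial_segment:
  assumes h: "bij_betw h A {..<card A}" "h ` T = {..<card T}" and i: "i \<in> {card T..<card A}"
  shows "inv_into A h i \<in> A - T"
proof -
  have "i \<in> h ` A" using h(1) i by (simp add: bij_betw_def)
  then have "inv_into A h i \<in> A" "h (inv_into A h i) = i"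
    by (auto intro: inv_into_into f_inv_into_f)
  moreover have "i \<notin> h ` T" using h(2) i by simp
  ultimately show ?thesis by (metis DiffI imageI)
qed

lemma graph_iso_if_pendant_structure:
  assumes "pendant_structure t A B"
  shows "\<exists>f. (\<forall>i\<in>{t..<card A}. f i < card B) \<and> G \<simeq>\<^sub>g pendant_extension t (card A) (card B) f"
proof -
  obtain T where T: "T \<subseteq> A" "card T = t" "complete_to T B"
    and pendant_nbr: "\<And>x. x \<in> A - T \<Longrightarrow> card (nbrs B x) = 1"
    using assms by (rule pendant_structureE) blast
  define n where "n x = the_elem (nbrs B x)" for x
  have n: "nbrs B x = {n x}" if "x \<in> A - T" for x
    using pendant_nbr[OF that] unfolding n_def by (metis card_1_singletonE the_elem_eq)
  obtain h where h: "bij_betw h A {..<card A}" "h ` T = {..<card T}"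
    using ex_bij_betw_initial_segment[OF finite_A T(1)] .
  obtain g where g: "bij_betw g B {..<card B}"
    using finite_same_card_bij[of B "{..<card B}"] by auto
  have "g (n (inv_into A h i)) < card B" if "i \<in> {t..<card A}" for i
  proof -
    have "n (inv_into A h i) \<in> nbrs B (inv_into A h i)"
      using n inv_into_initial_segment[OF h] that T(2) by blast
    then show ?thesis using g by (auto simp: bij_betw_def)
  qed
  then show ?thesis
    using graph_iso_pendant_extension[OF T(1,3) n h g] T(2)
    by (intro exI[of _ "\<lambda>i. g (n (inv_into A h i))"]) auto
qed

lemma graph_iso_if_pendant_structure_no_path:
  assumes "pendant_structure t A B" "1 \<le> t" "t + 2 \<le> card B"
    and no_path: "\<not> has_path (verts G) (2 * t + 3)"
  shows "G \<simeq>\<^sub>g pendant_extension t (card A) (card B) (\<lambda>_. 0)"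
proof -
  obtain T where T: "T \<subseteq> A" "card T = t" "complete_to T B"
    and pendant_nbr: "\<And>x. x \<in> A - T \<Longrightarrow> card (nbrs B x) = 1"
    using assms(1) by (rule pendant_structureE) blast
  have "T \<noteq> {}" "card T + 2 \<le> card B" "\<not> has_path (verts G) (2 * card T + 3)"
    using T(2) assms(2,3) no_path by auto
  then obtain y where y: "y \<in> B" "\<And>x. x \<in> A - T \<Longrightarrow> nbrs B x = {y}"
    using pendant_vertices_common_nbr[OF T(1,3) _ _ pendant_nbr] by blast
  obtain h where h: "bij_betw h A {..<card A}" "h ` T = {..<card T}"
    using ex_bij_betw_initial_segment[OF finite_A T(1)] .
  obtain g where g: "bij_betw g B {..<card B}" "g ` {y} = {..<card {y}}"
    using ex_bij_betw_initial_segment[OF finite_B, of "{y}"] y(1) by auto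
  have "g y = 0" using g(2) by (simp add: lessThan_Suc)
  then show ?thesis using graph_iso_pendant_extension[OF T(1,3) y(2) h g(1)] T(2) by simp
qed

lemma card_edges_if_graph_iso_pendant_extension:
  assumes "G \<simeq>\<^sub>g pendant_extension t a b f" "\<forall>i\<in>{t..<a}. f i < b" "t \<le> a"
  shows "card (edges G) = t * b + (a - t)"
proof -
  have "simple_graph (pendant_extension t a b f)"
    using assms(2,3) by (intro simple_graph_pendant_extension) auto
  then show ?thesis
    using graph_iso_card_edges[OF simple _ assms(1)] by (simp add: card_edges_pendant_extension)
qed

end

section \<open>The main theorem\<close>

locale connected_bipartite_ugraph = bipartite_ugraph +
  fixes t :: nat
  assumes connected: "connected_graph G"
    and t_ge: "2 \<le> t" "t + 2 \<le> card A" and card_le: "card A \<le> card B"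
    and no_path: "\<not> has_path (verts G) (2 * t + 4)"
begin

lemma extremal_bound: "extremal_bound t A B"
  using bipartite_axioms conn_verts_if_connected_graph[OF simple connected] t_ge(2) card_le no_path
  by (rule extremal_bound_if_no_path)

lemma card_edges_le: "card (edges G) \<le> t * card B + (card A - t)"
  using extremal_bound t_ge(2) unfolding extremal_bound_def card_edges_eq_edge_count by linarith

lemma pendant_structure_if_extremal:
  assumes "card (edges G) = t * card B + (card A - t)"
  shows "pendant_structure t A B \<or> card A = card B \<and> pendant_structure t B A"
  using extremal_bound assms t_ge by (simp add: extremal_bound_def card_edges_eq_edge_count)

lemma card_edges_eq_iff:
  "card (edges G) = t * card B + (card A - t) \<longleftrightarrow>
    (\<exists>f. (\<forall>i\<in>{t..<card A}. f i < card B) \<and> G \<simeq>\<^sub>g pendant_extension t (card A) (card B) f)"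
proof
  interpret flip: bipartite_ugraph G B A by (rule bipartite_ugraph_swap)
  assume "card (edges G) = t * card B + (card A - t)"
  then consider (in_A) "pendant_structure t A B"
    | (in_B) "card A = card B" "pendant_structure t B A"
    using pendant_structure_if_extremal by blast
  then show "\<exists>f. (\<forall>i\<in>{t..<card A}. f i < card B) \<and> G \<simeq>\<^sub>g pendant_extension t (card A) (card B) f"
  proof cases
    case in_A
    then show ?thesis by (rule graph_iso_if_pendant_structure)
  next
    case in_B
    then show ?thesis using flip.graph_iso_if_pendant_structure[OF in_B(2)] by simp
  qed
next
  assume "\<exists>f. (\<forall>i\<in>{t..<card A}. f i < card B) \<and> G \<simeq>\<^sub>g pendant_extension t (card A) (card B) f"
  then obtain f where "\<forall>i\<in>{t..<card A}. f i < card B"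
    and "G \<simeq>\<^sub>g pendant_extension t (card A) (card B) f"
    by blast
  moreover have "t \<le> card A" using t_ge(2) by simp
  ultimately show "card (edges G) = t * card B + (card A - t)"
    by (intro card_edges_if_graph_iso_pendant_extension)
qed

lemma card_edges_eq_iff_no_path:
  assumes "\<not> has_path (verts G) (2 * t + 3)"
  shows "card (edges G) = t * card B + (card A - t) \<longleftrightarrow>
    G \<simeq>\<^sub>g pendant_extension t (card A) (card B) (\<lambda>_. 0)"
proof
  interpret flip: bipartite_ugraph G B A by (rule bipartite_ugraph_swap)
  assume "card (edges G) = t * card B + (card A - t)"
  then consider (in_A) "pendant_structure t A B"
    | (in_B) "card A = card B" "pendant_structure t B A"
    using pendant_structure_if_extremal by blast
  then show "G \<simeq>\<^sub>g pendant_extension t (card A) (card B) (\<lambda>_. 0)"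
  proof cases
    case in_A
    then show ?thesis
      using t_ge card_le assms by (intro graph_iso_if_pendant_structure_no_path) auto
  next
    case in_B
    then show ?thesis
      using flip.graph_iso_if_pendant_structure_no_path[OF in_B(2)] t_ge assms by simp
  qed
next
  assume "G \<simeq>\<^sub>g pendant_extension t (card A) (card B) (\<lambda>_. 0)"
  then show "card (edges G) = t * card B + (card A - t)"
    using t_ge card_le by (intro card_edges_if_graph_iso_pendant_extension) auto
qed

end

theorem theorem2:
  fixes G :: "'a ugraph" and A B :: "'a set" and a b k t :: nat
  assumes "simple_graph G"
    and "connected_graph G"
    and "bipartition G A B"
    and "card A = a" and "card B = b"
    and "b \<ge> a" and "real a \<ge> real k / 2" and "real k / 2 \<ge> 4"
    and "path_free k G"
    and "t = t_par k"
  shows "int (card (edges G)) \<le> int t * int b + (int a - int t) \<and>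
    (odd k \<longrightarrow>
       (int (card (edges G)) = int t * int b + (int a - int t) \<longleftrightarrow> G \<simeq>\<^sub>g B1_graph a b k)) \<and>
    (even k \<longrightarrow>
       (int (card (edges G)) = int t * int b + (int a - int t) \<longleftrightarrow>
          (\<exists>H\<in>B1_family a b k. G \<simeq>\<^sub>g H)))"
proof -
  interpret bipartite_ugraph G A B using assms(1,3) by (rule bipartite_ugraph.intro)
  have k: "8 \<le> k" "k \<le> 2 * a" using assms(7,8) by linarith+
  have t: "2 \<le> t" "t + 2 \<le> a" "k \<le> 2 * t + 4" "odd k \<Longrightarrow> k = 2 * t + 3"
    using t_par_bounds[OF k] assms(10) by auto
  have no_k_path: "\<not> has_path (verts G) k" using assms(1,9) by (rule path_free_imp_no_path)
  then have "\<not> has_path (verts G) (2 * t + 4)"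
    using has_path_shorter[of "verts G" "2 * t + 4" k] k(1) t(3) by linarith
  then interpret connected_bipartite_ugraph G A B t
    using assms(2,4-6) t(1,2) by unfold_locales auto
  have bound: "int t * int b + (int a - int t) = int (t * card B + (card A - t))"
    using assms(4,5) t(2) by (simp add: of_nat_diff)
  have B1_graph: "B1_graph a b k = pendant_extension t (card A) (card B) (\<lambda>_. 0)"
    using assms(4,5,10) by (simp add: B1_graph_def)
  have B1_family: "(\<exists>H\<in>B1_family a b k. G \<simeq>\<^sub>g H) \<longleftrightarrow>
      (\<exists>f. (\<forall>i\<in>{t..<card A}. f i < card B) \<and> G \<simeq>\<^sub>g pendant_extension t (card A) (card B) f)"
    using assms(4,5,10) by (auto simp: B1_family_def)
  have "odd k \<longrightarrow> \<not> has_path (verts G) (2 * t + 3)" using no_k_path t(4) by auto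
  then show ?thesis
    unfolding bound of_nat_le_iff of_nat_eq_iff B1_graph B1_family
    using card_edges_le card_edges_eq_iff card_edges_eq_iff_no_path by blast
qed

end
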